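(* Let $F : \mathbb{N} \rightarrow \mathbb{N}$ be a nondecreasing function for which there exist $c,\epsilon > 0$ such that for all $n \in \mathbb{N}$, $$F(n) \geq \exp\big( c\, n \log (n)^2 \log\log (n)^{1+\epsilon} \big).$$ Then there exists a residually finite group $G$, generated by a finite set $S$, and $c_1, c_2, c_3 > 1$ such that $$F(n/c_1 - c_2)^{1 - c_3 \frac{\log\log\log F(n)}{\log\log F(n)}} \leq \mathcal{F}_G^S(n) \leq F(c_1 n + c_2)^{2 + c_3 \frac{\log\log\log F(n)}{\log\log F(n)}}$$ for all $n \in \mathbb{N}$.
   Context: For a function $F:\mathbb{N}\to\mathbb{N}$ and $x\in(0,\infty)$ not an integer, $F(x)$ means $F(\lceil x\rceil)$. A group $G$ is residually finite if for every nontrivial $g\in G$ there is a finite-index subgroup of $G$ not containing $g$. For $G$ generated by a finite set $S$, let $B_S(n)=\{s_1\cdots s_m : 0\le m\le n,\ s_i\in S\cup S^{-1}\}$. The normal depth of a nontrivial $g\in G$ is the minimal index of a finite-index normal subgroup of $G$ not containing $g$. The residual finiteness growth function $\mathcal{F}_G^S:\mathbb{N}\to\mathbb{N}$ is defined by letting $\mathcal{F}_G^S(n)$ be the maximal normal depth occurring among the nontrivial elements of $B_S(n)$.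
   Formalization: The quotient logloglog F(n)/loglog F(n) is taken as 0 when F(n) < e^e (there it is undefined, or negative and the upper bound fails, e.g. F(3)=3); the growth hypothesis is required only for n ≥ 3, and the lower bound is stated only when n/c_1 - c_2 > 0. *)

theory Defs
  imports Complex_Main "HOL-Algebra.Coset" "HOL-Algebra.Generated_Groups"
begin

definition residually_finite :: "('a, 'b) monoid_scheme \<Rightarrow> bool" where
  "residually_finite G \<longleftrightarrow>
     (\<forall>g \<in> carrier G. g \<noteq> \<one>\<^bsub>G\<^esub> \<longrightarrow>
        (\<exists>H. subgroup H G \<and> finite (rcosets\<^bsub>G\<^esub> H) \<and> g \<notin> H))"

definition word_ball :: "('a, 'b) monoid_scheme \<Rightarrow> 'a set \<Rightarrow> nat \<Rightarrow> 'a set" where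
  "word_ball G S n =
     {foldr (mult G) ws \<one>\<^bsub>G\<^esub> |ws. length ws \<le> n \<and> set ws \<subseteq> S \<union> m_inv G ` S}"

(* Finiteness of the index is a separate condition because card is 0 on infinite sets.
   The value is meaningful only if some such subgroup exists, which residual finiteness
   guarantees for every nontrivial g. *)
definition normal_depth :: "('a, 'b) monoid_scheme \<Rightarrow> 'a \<Rightarrow> nat" where
  "normal_depth G g =
     (LEAST k. \<exists>N. N \<lhd> G \<and> finite (rcosets\<^bsub>G\<^esub> N) \<and> g \<notin> N \<and> k = card (rcosets\<^bsub>G\<^esub> N))"

(* For finite S the ball is finite, so Sup is the maximum whenever the ball contains a
   nontrivial element; otherwise (for instance at n = 0) Sup {} = 0 on nat. *)
definition rf_growth :: "('a, 'b) monoid_scheme \<Rightarrow> 'a set \<Rightarrow> nat \<Rightarrow> nat" where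
  "rf_growth G S n = Sup (normal_depth G ` (word_ball G S n - {\<one>\<^bsub>G\<^esub>}))"

(* The convention F(x) = F(ceiling x), to be used only for x > 0. *)
definition at_real :: "(nat \<Rightarrow> nat) \<Rightarrow> real \<Rightarrow> nat" where
  "at_real F x = F (nat \<lceil>x\<rceil>)"

(* log log log x / log log x, taken to be 0 below exp (exp 1), where log log log x is
   undefined or negative.  The raw quotient tends to minus infinity as x decreases to
   exp 1: at x = 3 it is below -20, and an exponent 2 + c * (raw quotient) with c > 1
   would be negative there. *)
definition iterated_log_ratio :: "real \<Rightarrow> real" where
  "iterated_log_ratio x = (if exp (exp 1) \<le> x then ln (ln (ln x)) / ln (ln x) else 0)"

end

(*
  Let t, a, b act on triples (l, f, e), with l in an index set A, f : Z -> F_2 and e in F_2: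
  t shifts f, a adds to f the pulse of level l, the indicator function of 2^kappa(l) + 2^l Z, and
  b adds f(0) to e.  The conjugates a_j of a under powers of t commute with each other, and so do
  the conjugates b_k of b; the commutator [b_k, a_j] is the central involution that adds to e the
  value of the pulse at j + k.  On the 2^l-periodic functions f, level l is a finite quotient of
  order at most 2 * 2^l * 4^(2^l).  Put A = range e, where e(k) is the least e with
  F(D 2^k) <= 4^(2^e), and let kappa(l) be the least k with e(k) = l; then 4^(2^e(k)) lies between
  F(D 2^k) and F(D 2^k)^2.  The pulse of level l vanishes near 0 up to the distance 2^kappa(l), so
  short words cannot see the central coordinates of high level and any nontrivial word of length n
  survives in a level l with 2^l at most about log F(2 D n).  Conversely, the involution that
  changes e at level l alone is a word of length 4 * 2^kappa(l) + 4, and a normal subgroup that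
  misses it has index at least 4^(2^l), because the commutator pairing at level l stays
  nondegenerate.
*)
theory Submission
  imports Defs "HOL-Library.Z2" "HOL-Library.Countable_Set" "HOL-Algebra.Weak_Morphisms"
begin

section \<open>Finite differences and pulse combinations over the field with two elements\<close>

definition diff_op :: "(int \<Rightarrow> bit) \<Rightarrow> int \<Rightarrow> bit" where
  "diff_op f d = f (d + 1) + f d"

(* The default simp rules turn + on type bit into XOR, which blocks arithmetic normalization. *)
declare add_bit_eq_xor [simp del] mult_bit_eq_and [simp del] bit_not_zero_iff [simp del] bit_not_one_iff [simp del]

lemma bit_add_self [simp]: "(x :: bit) + x = 0"
  by (cases x) auto

text \<open>In characteristic 2 the common part is counted twice and cancels. Finite sets under
  symmetric difference thus serve as finitely supported vectors over F_2.\<close>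

lemma sum_sym_diff_bit:
  fixes f :: "'a \<Rightarrow> bit"
  assumes "finite A" "finite B"
  shows "sum f (sym_diff A B) = sum f A + sum f B"
proof -
  have A: "sum f A = sum f (A - B) + sum f (A \<inter> B)"
    using assms by (subst sum.union_disjoint [symmetric]) (auto intro!: arg_cong [where f = "sum f"])
  have B: "sum f B = sum f (B - A) + sum f (A \<inter> B)"
    using assms by (subst sum.union_disjoint [symmetric]) (auto intro!: arg_cong [where f = "sum f"])
  have "sum f (sym_diff A B) = sum f (A - B) + sum f (B - A)"
    using assms by (intro sum.union_disjoint) auto
  also have "\<dots> = sum f A + sum f B"
    unfolding A B by (cases "sum f (A \<inter> B)") (auto simp: ac_simps)
  finally show ?thesis .
qed

text \<open>Freshman's dream: with E the shift by 1, \<open>diff_op\<close> is E + 1, and its power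
  of order 2^l is E^(2^l) + 1 in characteristic 2.\<close>

lemma diff_op_pow2: "(diff_op ^^ (2 ^ l)) f d = f (d + 2 ^ l) + f d"
proof (induction l arbitrary: f d)
  case 0
  show ?case by (simp add: diff_op_def)
next
  case (Suc l)
  have "(diff_op ^^ (2 ^ Suc l)) f d = (diff_op ^^ (2 ^ l)) ((diff_op ^^ (2 ^ l)) f) d"
    by (simp add: mult_2 funpow_add)
  also have "\<dots> = f (d + 2 ^ l + 2 ^ l) + f (d + 2 ^ l) + (f (d + 2 ^ l) + f d)"
    by (simp add: Suc.IH)
  also have "\<dots> = f (d + 2 ^ Suc l) + f d"
    by (simp add: algebra_simps)
  finally show ?case .
qed

lemma diff_op_funpow_shift: "(diff_op ^^ k) (\<lambda>d. f (d + c)) d = (diff_op ^^ k) f (d + c)"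
  by (induction k arbitrary: d) (simp_all add: diff_op_def ac_simps)

lemma diff_op_funpow_const_zero: "(diff_op ^^ k) (\<lambda>d. 0) d = 0"
  by (induction k arbitrary: d) (simp_all add: diff_op_def)

lemma diff_op_funpow_vanish:
  assumes "\<And>x. d \<le> x \<Longrightarrow> x \<le> d + int k \<Longrightarrow> f x = 0"
  shows "(diff_op ^^ k) f d = 0"
  using assms
proof (induction k arbitrary: d)
  case (Suc k)
  have "(diff_op ^^ k) f d = 0" "(diff_op ^^ k) f (d + 1) = 0"
    by (rule Suc.IH, rule Suc.prems, simp_all)+
  then show ?case by (simp add: diff_op_def [of "(diff_op ^^ k) f"])
qed simp

lemma diff_op_zero_imp_const:
  assumes "\<And>d. diff_op f d = 0"
  shows "f x = f 0"
proof (induction x rule: int_induct [where k = 0])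
  case (step1 i)
  then show ?case using assms [of i] by (cases "f (i + 1)"; cases "f i") (auto simp: diff_op_def)
next
  case (step2 i)
  then show ?case using assms [of "i - 1"] by (cases "f (i - 1)"; cases "f i") (auto simp: diff_op_def)
qed simp

text \<open>By \<open>diff_op_pow2\<close>, differencing is nilpotent on functions of period
  \<open>2 ^ l\<close>. The last nonzero iterate has zero difference, so it is constant.\<close>

lemma diff_op_reaches_one:
  assumes per: "\<And>d. f (d + 2 ^ l) = f d" and nz: "f d0 \<noteq> 0"
  obtains k where "k < 2 ^ l" "\<And>d. (diff_op ^^ k) f d = 1"
proof -
  define K where "K = (LEAST k. \<forall>d. (diff_op ^^ k) f d = 0)"
  have ex: "\<forall>d. (diff_op ^^ (2 ^ l)) f d = 0" by (simp add: diff_op_pow2 per)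
  have K: "\<forall>d. (diff_op ^^ K) f d = 0" unfolding K_def by (rule LeastI [of _ "2 ^ l"]) (rule ex)
  have Kle: "K \<le> 2 ^ l" unfolding K_def by (rule Least_le) (rule ex)
  have "K \<noteq> 0" using K nz by (metis funpow_0)
  then obtain k where k: "K = Suc k" by (cases K) auto
  have "\<not> (\<forall>d. (diff_op ^^ k) f d = 0)"
    using not_less_Least [of k "\<lambda>k. \<forall>d. (diff_op ^^ k) f d = 0"] k unfolding K_def by auto
  then obtain d1 where d1: "(diff_op ^^ k) f d1 = 1" by (auto simp: bit_not_zero_iff)
  have "(diff_op ^^ k) f x = (diff_op ^^ k) f 0" for x
    by (rule diff_op_zero_imp_const) (use K k in auto)
  with d1 have "(diff_op ^^ k) f d = 1" for d by metis
  moreover have "k < 2 ^ l" using Kle k by simp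
  ultimately show thesis using that by blast
qed

section \<open>Sums of indicator functions of residue classes\<close>

definition comb :: "int set \<Rightarrow> nat \<Rightarrow> int \<Rightarrow> bit" where
  "comb U l d = (\<Sum>j\<in>U. of_bool (2 ^ l dvd d + j))"

lemma of_bool_dvd_pow2_Suc:
  "(of_bool (2 ^ l dvd d) :: bit) = of_bool (2 ^ Suc l dvd d + 2 ^ l) + of_bool (2 ^ Suc l dvd d)"
  for d :: int
proof (cases "2 ^ l dvd d")
  case True
  then obtain q where q: "d = 2 ^ l * q" by blast
  have 1: "2 ^ Suc l dvd d \<longleftrightarrow> even q" by (simp add: q)
  have "d + 2 ^ l = 2 ^ l * (q + 1)" by (simp add: q algebra_simps)
  then have 2: "2 ^ Suc l dvd d + 2 ^ l \<longleftrightarrow> odd q" by simp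
  show ?thesis using True by (simp only: 1 2) simp
next
  case False
  then have "\<not> 2 ^ Suc l dvd d" "\<not> 2 ^ Suc l dvd d + 2 ^ l"
    by (meson dvd_trans le_imp_power_dvd lessI less_imp_le,
        metis dvd_add_left_iff dvd_refl dvd_trans le_imp_power_dvd lessI less_imp_le)
  with False show ?thesis by simp
qed

text \<open>A class modulo 2^l is the union of two classes modulo 2^(l+1) that differ by the shift
  2^l. Each level is therefore an iterated difference of the next one, and one order of differencing
  can kill all lower levels at once.\<close>

lemma comb_diff_op: "comb U l = (diff_op ^^ (2 ^ l)) (comb U (Suc l))"
proof
  fix d
  have "comb U l d = (\<Sum>j\<in>U. of_bool (2 ^ Suc l dvd (d + j) + 2 ^ l) + of_bool (2 ^ Suc l dvd d + j))"
    unfolding comb_def by (intro sum.cong refl of_bool_dvd_pow2_Suc)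
  also have "\<dots> = comb U (Suc l) (d + 2 ^ l) + comb U (Suc l) d"
    by (simp add: comb_def sum.distrib ac_simps)
  finally show "comb U l d = (diff_op ^^ (2 ^ l)) (comb U (Suc l)) d"
    by (simp add: diff_op_pow2)
qed

lemma comb_period: "comb U l (d + 2 ^ l) = comb U l d"
proof -
  have "2 ^ l dvd d + 2 ^ l + j \<longleftrightarrow> 2 ^ l dvd d + j" for j :: int
    by (metis add.assoc add.commute dvd_add_triv_left_iff)
  then show ?thesis by (simp add: comb_def)
qed

lemma sum_of_bool_eq_one:
  assumes "finite U" "u \<in> U" "\<And>j. j \<in> U \<Longrightarrow> P j \<longleftrightarrow> j = u"
  shows "(\<Sum>j\<in>U. of_bool (P j) :: bit) = 1"
proof -
  have "(\<Sum>j\<in>U. of_bool (P j) :: bit) = (\<Sum>j\<in>U. if j = u then 1 else 0)"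
    using assms(3) by (intro sum.cong) auto
  then show ?thesis using assms by simp
qed

lemma dvd_small_int: "(m::int) dvd x \<Longrightarrow> \<bar>x\<bar> < m \<Longrightarrow> x = 0"
  using zdvd_imp_le [of m "\<bar>x\<bar>"] by fastforce

text \<open>Members of a window of length 2^i stay distinct modulo 2^l, so level \<open>l\<close> is
  not zero and some iterate makes it constant 1. The lower levels are further differences of that
  constant and vanish.\<close>

lemma comb_reaches_one:
  assumes U: "U \<noteq> {}" "U \<subseteq> {0..<2 ^ i}" and il: "i \<le> l"
  obtains k where "k < 2 ^ l" "\<And>d. (diff_op ^^ k) (comb U l) d = 1"
    "\<And>l' d. l' < l \<Longrightarrow> (diff_op ^^ k) (comb U l') d = 0"
proof -
  obtain u where u: "u \<in> U" using U by blast
  have fin: "finite U" using U(2) by (rule finite_subset) simp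
  have le: "(2::int) ^ i \<le> 2 ^ l" using il by simp
  have "comb U l (- u) = 1"
    unfolding comb_def
  proof (rule sum_of_bool_eq_one [OF fin u])
    fix j assume "j \<in> U"
    then have "0 \<le> j" "j < 2 ^ i" "0 \<le> u" "u < 2 ^ i" using u U(2) by auto
    then have "\<bar>- u + j\<bar> < 2 ^ l" using le by linarith
    then show "2 ^ l dvd - u + j \<longleftrightarrow> j = u" using dvd_small_int by fastforce
  qed
  then have nz: "comb U l (- u) \<noteq> 0" by simp
  obtain k where k: "k < 2 ^ l" and one: "\<And>d. (diff_op ^^ k) (comb U l) d = 1"
    using diff_op_reaches_one [of "comb U l" l, OF comb_period nz] by blast
  have step: "(diff_op ^^ k) (comb U l') = (diff_op ^^ (2 ^ l')) ((diff_op ^^ k) (comb U (Suc l')))" for l'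
    by (subst comb_diff_op) (metis add.commute comp_apply funpow_add)
  have zero: "(diff_op ^^ k) (comb U l') d = 0" if "l' < l" for l' d
    using that
  proof (induction "l - Suc l'" arbitrary: l' d)
    case 0
    then have "Suc l' = l" by simp
    then show ?case by (simp add: step [of l'] diff_op_pow2 one)
  next
    case (Suc x)
    then have "x = l - Suc (Suc l')" "Suc l' < l" by simp_all
    from Suc(1) [OF this] show ?case by (simp add: step [of l'] diff_op_pow2)
  qed
  show thesis using that [OF k one zero] .
qed

text \<open>The gap of 2 keeps the offset \<open>2 ^ \<kappa> l\<close> within a quarter of the
  period \<open>2 ^ l\<close>; \<open>basis_vector_mem\<close> spends this margin. Strict
  monotonicity lets the point \<open>2 ^ \<kappa> i\<close> isolate level \<open>i\<close>.\<close>

locale pulses =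
  fixes A :: "nat set" and \<kappa> :: "nat \<Rightarrow> nat"
  assumes kappa_le: "l \<in> A \<Longrightarrow> \<kappa> l + 2 \<le> l"
    and kappa_less: "l \<in> A \<Longrightarrow> l' \<in> A \<Longrightarrow> l < l' \<Longrightarrow> \<kappa> l < \<kappa> l'"
begin

definition pulse :: "nat \<Rightarrow> int \<Rightarrow> bit" where
  "pulse l d = of_bool (l \<in> A \<and> 2 ^ l dvd d - 2 ^ \<kappa> l)"

lemma pow_kappa_le: "l \<in> A \<Longrightarrow> 4 * (2::int) ^ \<kappa> l \<le> 2 ^ l"
  using kappa_le [of l] power_increasing [of "\<kappa> l + 2" l "2::int"] by simp

lemma pulse_period: "pulse l (d + 2 ^ l) = pulse l d"
proof -
  have "d + 2 ^ l - 2 ^ \<kappa> l = (d - 2 ^ \<kappa> l) + 2 ^ l" by simp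
  then show ?thesis unfolding pulse_def by (simp only: dvd_add_triv_right_iff)
qed

lemma pulse_small: "\<bar>d\<bar> < 2 ^ \<kappa> l \<Longrightarrow> pulse l d = 0"
proof (rule ccontr)
  assume d: "\<bar>d\<bar> < 2 ^ \<kappa> l" and "pulse l d \<noteq> 0"
  then have "l \<in> A" "2 ^ l dvd d - 2 ^ \<kappa> l" by (auto simp: pulse_def split: if_splits)
  moreover have "\<bar>d - 2 ^ \<kappa> l\<bar> < 2 ^ l" using d pow_kappa_le [OF \<open>l \<in> A\<close>] by linarith
  ultimately have "d - 2 ^ \<kappa> l = 0" using dvd_small_int by blast
  then show False using d by simp
qed

text \<open>For \<open>l\<close> below \<open>i\<close> the difference of the two powers has 2-adic
  valuation \<open>\<kappa> l\<close>, which is less than \<open>l\<close>; for \<open>l\<close>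
  above \<open>i\<close> the point is too close to 0 for the pulse. Hence a single commutator can
  change a single central coordinate.\<close>

lemma pulse_pow_kappa:
  assumes i: "i \<in> A"
  shows "pulse l (2 ^ \<kappa> i) = of_bool (l = i)"
proof (cases "l \<in> A")
  case l: True
  consider "l = i" | "l < i" | "i < l" by linarith
  then show ?thesis
  proof cases
    case 1
    then show ?thesis using l by (simp add: pulse_def)
  next
    case 2
    have "\<not> 2 ^ l dvd (2::int) ^ \<kappa> i - 2 ^ \<kappa> l"
    proof
      assume d: "2 ^ l dvd (2::int) ^ \<kappa> i - 2 ^ \<kappa> l"
      have "(2::int) ^ Suc (\<kappa> l) dvd 2 ^ l" by (rule le_imp_power_dvd) (use kappa_le [OF l] in simp)
      moreover have "(2::int) ^ Suc (\<kappa> l) dvd 2 ^ \<kappa> i"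
        by (rule le_imp_power_dvd) (use kappa_less [OF l i 2] in simp)
      ultimately have "(2::int) ^ Suc (\<kappa> l) dvd 2 ^ \<kappa> i - (2 ^ \<kappa> i - 2 ^ \<kappa> l)"
        using d by (meson dvd_diff dvd_trans)
      then have "(2::int) ^ Suc (\<kappa> l) dvd 2 ^ \<kappa> l" by simp
      then show False using zdvd_imp_le by fastforce
    qed
    with 2 show ?thesis by (simp add: pulse_def)
  next
    case 3
    have "\<bar>2 ^ \<kappa> i :: int\<bar> < 2 ^ \<kappa> l" using kappa_less [OF i l 3] by simp
    then show ?thesis using 3 pulse_small by simp
  qed
qed (use i in \<open>auto simp: pulse_def\<close>)

lemma sum_pulse_eq_comb:
  "(\<Sum>j\<in>U. pulse l (d + j)) = (if l \<in> A then comb U l (d - 2 ^ \<kappa> l) else 0)"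
  by (auto simp: pulse_def comb_def algebra_simps intro!: sum.cong)

text \<open>Differencing annihilates the coordinates below \<open>i\<close>, and those above
  \<open>Suc i\<close> vanish on a window. The period of coordinate \<open>Suc i\<close> may be too short for
  that window, so its basis vector is produced first and used to clear this coordinate.\<close>

lemma basis_vector_mem:
  assumes add: "\<And>x y. x \<in> Z \<Longrightarrow> y \<in> Z \<Longrightarrow> (\<lambda>l. x l + y l) \<in> Z"
    and U: "U \<noteq> {}" "U \<subseteq> {0..<2 ^ i}" and i: "i \<in> A"
    and mem: "\<And>d. (\<lambda>l. \<Sum>j\<in>U. pulse l (d + j)) \<in> Z"
  shows "(\<lambda>l. of_bool (l = i)) \<in> Z"
proof -
  define \<psi> where "\<psi> = (\<lambda>l d. \<Sum>j\<in>U. pulse l (d + j))"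
  have psi: "\<psi> l = (\<lambda>d. if l \<in> A then comb U l (d + (- (2 ^ \<kappa> l))) else 0)" for l
    by (simp add: \<psi>_def sum_pulse_eq_comb fun_eq_iff)
  have Dpsi: "(diff_op ^^ k) (\<psi> l) d = (if l \<in> A then (diff_op ^^ k) (comb U l) (d - 2 ^ \<kappa> l) else 0)" for k l d
    using diff_op_funpow_shift [of k "comb U l" "- (2 ^ \<kappa> l)" d]
    by (simp add: psi diff_op_funpow_const_zero)
  have memD: "(\<lambda>l. (diff_op ^^ k) (\<psi> l) d) \<in> Z" for k d
  proof (induction k arbitrary: d)
    case 0
    show ?case using mem by (simp add: \<psi>_def)
  next
    case (Suc k)
    show ?case using add [OF Suc [of "d + 1"] Suc [of d]] by (simp add: diff_op_def)
  qed
  \<comment> \<open>Differences of order below 2 * 2^i at \<open>d0\<close>, shifted by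
    \<open>j\<close>, read only arguments between 1 - 3 * 2^i and -1. For \<open>l\<close> at least
    i + 2 these lie less than one period to the left of \<open>2 ^ \<kappa> l\<close>, so they miss
    the support of the pulse. The same \<open>d0\<close> serves both orders \<open>k\<close>
    obtained below.\<close>
  define d0 :: int where "d0 = 1 - 3 * 2 ^ i"
  have high: "(diff_op ^^ k) (\<psi> l) d0 = 0" if k: "k < 2 ^ Suc i" and l: "Suc i < l" for k l
  proof (rule diff_op_funpow_vanish)
    fix x assume x: "d0 \<le> x" "x \<le> d0 + int k"
    have k': "int k < 2 * 2 ^ i" using k by (metis of_nat_less_iff of_nat_numeral of_nat_power power_Suc)
    show "\<psi> l x = 0"
      unfolding \<psi>_def
    proof (intro sum.neutral ballI)
      fix j assume "j \<in> U"
      then have j: "0 \<le> j" "j < 2 ^ i" using U by auto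
      show "pulse l (x + j) = 0"
      proof (rule ccontr)
        assume "pulse l (x + j) \<noteq> 0"
        then have lA: "l \<in> A" and dv: "2 ^ l dvd x + j - 2 ^ \<kappa> l" by (auto simp: pulse_def split: if_splits)
        have "4 * (2::int) ^ i \<le> 2 ^ l" using l power_increasing [of "i + 2" l "2::int"] by simp
        then have "\<bar>x + j - 2 ^ \<kappa> l\<bar> < 2 ^ l" "x + j - 2 ^ \<kappa> l < 0"
          using pow_kappa_le [OF lA] x k' j zero_less_power [of "2::int" "\<kappa> l"] unfolding d0_def by linarith+
        then show False using dvd_small_int [OF dv] by simp
      qed
    qed
  qed
  have next_mem: "(\<lambda>l. of_bool (l = Suc i)) \<in> Z" if A: "Suc i \<in> A"
  proof -
    obtain k where k: "k < 2 ^ Suc i" "\<And>d. (diff_op ^^ k) (comb U (Suc i)) d = 1"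
        "\<And>l' d. l' < Suc i \<Longrightarrow> (diff_op ^^ k) (comb U l') d = 0"
      using comb_reaches_one [OF U, of "Suc i"] by auto
    have "(diff_op ^^ k) (\<psi> l) d0 = of_bool (l = Suc i)" for l
      using high [OF k(1), of l] k A by (cases l "Suc i" rule: linorder_cases) (auto simp: Dpsi)
    then show ?thesis using memD [of k d0] by simp
  qed
  obtain k where k: "k < 2 ^ i" "\<And>d. (diff_op ^^ k) (comb U i) d = 1"
      "\<And>l' d. l' < i \<Longrightarrow> (diff_op ^^ k) (comb U l') d = 0"
    using comb_reaches_one [OF U, of i] by auto
  have k': "k < 2 ^ Suc i" using k(1) by simp
  define c where "c = (diff_op ^^ k) (\<psi> (Suc i)) d0"
  have eq: "(diff_op ^^ k) (\<psi> l) d0 = of_bool (l = i) + (if l = Suc i then c else 0)" for l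
  proof -
    consider "l < i" | "l = i" | "l = Suc i" | "Suc i < l" by linarith
    then show ?thesis
    proof cases
      case 1 then show ?thesis using k by (simp add: Dpsi)
    next
      case 2 then show ?thesis using k i by (simp add: Dpsi)
    next
      case 3 then show ?thesis by (simp add: c_def)
    next
      case 4 then show ?thesis using high [OF k'] by simp
    qed
  qed
  show ?thesis
  proof (cases "c = 0")
    case True
    then show ?thesis using memD [of k d0] by (simp add: eq cong: if_cong)
  next
    case False
    then have c: "c = 1" by (simp add: bit_not_zero_iff)
    then have "Suc i \<in> A" using Dpsi [of k "Suc i" d0] by (auto simp: c_def split: if_splits)
    from add [OF memD [of k d0] next_mem [OF this]]
    have "(\<lambda>l. of_bool (l = i) + (if l = Suc i then c else 0) + of_bool (l = Suc i)) \<in> Z"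
      by (simp add: eq)
    moreover have "(\<lambda>l. of_bool (l = i) + (if l = Suc i then c else 0) + of_bool (l = Suc i)) = (\<lambda>l. of_bool (l = i) :: bit)"
      by (auto simp: c)
    ultimately show ?thesis by simp
  qed
qed

end

section \<open>Word balls, indices and normal depth\<close>

lemma (in monoid) foldr_mult_closed:
  "set ws \<subseteq> carrier G \<Longrightarrow> foldr (\<otimes>) ws \<one> \<in> carrier G"
  by (induction ws) auto

lemma (in monoid) foldr_mult_append:
  "set us \<subseteq> carrier G \<Longrightarrow> set ws \<subseteq> carrier G \<Longrightarrow>
    foldr (\<otimes>) (us @ ws) \<one> = foldr (\<otimes>) us \<one> \<otimes> foldr (\<otimes>) ws \<one>"
  by (induction us) (auto simp: m_assoc foldr_mult_closed)

context group
begin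

lemma word_ball_one: "\<one> \<in> word_ball G S n"
  unfolding word_ball_def by (intro CollectI exI [of _ "[]"]) auto

lemma word_ball_gen: "S \<subseteq> carrier G \<Longrightarrow> s \<in> S \<union> m_inv G ` S \<Longrightarrow> s \<in> word_ball G S 1"
  unfolding word_ball_def by (intro CollectI exI [of _ "[s]"]) auto

lemma word_ball_mono: "m \<le> n \<Longrightarrow> word_ball G S m \<subseteq> word_ball G S n"
  unfolding word_ball_def by fastforce

lemma word_ball_mult:
  assumes "S \<subseteq> carrier G" "x \<in> word_ball G S m" "y \<in> word_ball G S n"
  shows "x \<otimes> y \<in> word_ball G S (m + n)"
proof -
  obtain us ws where "x = foldr (\<otimes>) us \<one>" "length us \<le> m" "set us \<subseteq> S \<union> m_inv G ` S"
      and "y = foldr (\<otimes>) ws \<one>" "length ws \<le> n" "set ws \<subseteq> S \<union> m_inv G ` S"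
    using assms(2,3) unfolding word_ball_def by blast
  moreover from this have "set us \<subseteq> carrier G" "set ws \<subseteq> carrier G" using assms(1) by auto
  ultimately have "x \<otimes> y = foldr (\<otimes>) (us @ ws) \<one>" "length (us @ ws) \<le> m + n"
      "set (us @ ws) \<subseteq> S \<union> m_inv G ` S"
    using foldr_mult_append [of us ws] by simp_all
  then show ?thesis unfolding word_ball_def by blast
qed

text \<open>The base case is required at every radius because a ball of radius \<open>n\<close> also
  contains shorter words.\<close>

lemma word_ball_induct [consumes 2, case_names one step]:
  assumes "S \<subseteq> carrier G" "x \<in> word_ball G S n"
    and one: "\<And>n. P n \<one>"
    and step: "\<And>s x n. s \<in> S \<union> m_inv G ` S \<Longrightarrow> x \<in> carrier G \<Longrightarrow> P n x \<Longrightarrow> P (Suc n) (s \<otimes> x)"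
  shows "P n x"
proof -
  obtain ws where ws: "x = foldr (\<otimes>) ws \<one>" "length ws \<le> n" "set ws \<subseteq> S \<union> m_inv G ` S"
    using assms(2) unfolding word_ball_def by blast
  have "S \<union> m_inv G ` S \<subseteq> carrier G" using assms(1) by auto
  with ws(2,3) have "P n (foldr (\<otimes>) ws \<one>)"
  proof (induction ws arbitrary: n)
    case (Cons s ws)
    then obtain n' where n': "n = Suc n'" by (cases n) auto
    show ?case
      using Cons unfolding n' by (auto intro!: step foldr_mult_closed)
  qed (simp add: one)
  then show ?thesis by (simp add: ws(1))
qed

lemma word_ball_subset_carrier: "S \<subseteq> carrier G \<Longrightarrow> word_ball G S n \<subseteq> carrier G"
  unfolding word_ball_def by (auto intro!: foldr_mult_closed)

lemma generate_word_ball: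
  assumes S: "S \<subseteq> carrier G" and "x \<in> generate G S"
  shows "\<exists>n. x \<in> word_ball G S n"
  using assms(2)
proof (induction rule: generate.induct)
  case one
  show ?case using word_ball_one by blast
next
  case (incl h)
  then show ?case using word_ball_gen [OF S, of h] by blast
next
  case (inv h)
  then show ?case using word_ball_gen [OF S, of "inv h"] by blast
next
  case (eng h1 h2)
  then show ?case using word_ball_mult [OF S] by blast
qed

text \<open>Countability allows a finitely generated group of maps to be transported to a carrier of
  natural numbers.\<close>

lemma countable_generate:
  assumes S: "S \<subseteq> carrier G" "countable S"
  shows "countable (generate G S)"
proof (rule countable_subset)
  show "generate G S \<subseteq> (\<lambda>ws. foldr (\<otimes>) ws \<one>) ` lists (S \<union> m_inv G ` S)"
  proof
    fix x assume "x \<in> generate G S"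
    then obtain n where "x \<in> word_ball G S n" using generate_word_ball [OF S(1)] by blast
    then show "x \<in> (\<lambda>ws. foldr (\<otimes>) ws \<one>) ` lists (S \<union> m_inv G ` S)"
      unfolding word_ball_def by (auto simp: lists_eq_set)
  qed
  show "countable ((\<lambda>ws. foldr (\<otimes>) ws \<one>) ` lists (S \<union> m_inv G ` S))"
    using S(2) by (intro countable_image countable_lists) auto
qed

section \<open>Bounding an index from above by keys and from below by separated families\<close>

lemma rcosets_card_le:
  assumes H: "subgroup H G" and fin: "finite K"
    and key: "\<And>x. x \<in> carrier G \<Longrightarrow> key x \<in> K"
    and eq: "\<And>x y. x \<in> carrier G \<Longrightarrow> y \<in> carrier G \<Longrightarrow> key x = key y \<Longrightarrow> x \<otimes> inv y \<in> H"
  shows "finite (rcosets H)" "card (rcosets H) \<le> card K"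
proof -
  define rep where "rep C = (SOME x. x \<in> carrier G \<and> C = H #> x)" for C
  have rep: "rep C \<in> carrier G \<and> C = H #> rep C" if "C \<in> rcosets H" for C
    unfolding rep_def by (rule someI_ex) (use that in \<open>auto simp: RCOSETS_def\<close>)
  have inj: "inj_on (\<lambda>C. key (rep C)) (rcosets H)"
  proof (rule inj_onI)
    fix C D assume CD: "C \<in> rcosets H" "D \<in> rcosets H" "key (rep C) = key (rep D)"
    note r = rep [OF CD(1)] rep [OF CD(2)]
    have "rep C \<otimes> inv (rep D) \<in> H" using eq r CD(3) by blast
    then have "H #> (rep C \<otimes> inv (rep D)) = H"
      using r H by (intro coset_join2) auto
    then have "H #> rep C = H #> rep D"
      using r H by (intro coset_mult_inv1) (auto dest: subgroup.subset)
    then show "C = D" using r by simp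
  qed
  have img: "(\<lambda>C. key (rep C)) ` (rcosets H) \<subseteq> K" using rep key by blast
  show "finite (rcosets H)" using inj_on_finite [OF inj img fin] .
  show "card (rcosets H) \<le> card K" using card_inj_on_le [OF inj img fin] .
qed

lemma rcosets_card_ge:
  assumes H: "subgroup H G" and fin: "finite (rcosets H)"
    and f: "\<And>p. p \<in> K \<Longrightarrow> f p \<in> carrier G"
    and sep: "\<And>p q. p \<in> K \<Longrightarrow> q \<in> K \<Longrightarrow> f p \<otimes> inv (f q) \<in> H \<Longrightarrow> p = q"
  shows "card K \<le> card (rcosets H)"
proof (rule card_inj_on_le [OF _ _ fin])
  show "inj_on (\<lambda>p. H #> f p) K"
  proof (rule inj_onI)
    fix p q assume pq: "p \<in> K" "q \<in> K" "H #> f p = H #> f q"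
    have sub: "H \<subseteq> carrier G" using H by (rule subgroup.subset)
    have "H #> (f p \<otimes> inv (f q)) = H"
      using coset_mult_inv2 [OF pq(3) f [OF pq(1)] f [OF pq(2)] sub] .
    then have "f p \<otimes> inv (f q) \<in> H"
      by (rule coset_join1) (use f pq H in auto)
    then show "p = q" using sep pq by blast
  qed
  show "(\<lambda>p. H #> f p) ` K \<subseteq> rcosets H" using f by (auto simp: RCOSETS_def)
qed

section \<open>Normal depth and residual finiteness growth\<close>

lemma normal_depth_le:
  assumes "N \<lhd> G" "finite (rcosets N)" "g \<notin> N" "card (rcosets N) \<le> B"
  shows "normal_depth G g \<le> B"
proof -
  have "normal_depth G g \<le> card (rcosets N)"
    unfolding normal_depth_def by (rule Least_le) (use assms in blast)
  with assms(4) show ?thesis by simp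
qed

text \<open>The subgroup \<open>N0\<close> makes the set of candidate indices nonempty, so the least
  one is attained by an actual subgroup.\<close>

lemma normal_depth_ge:
  assumes ex: "N0 \<lhd> G" "finite (rcosets N0)" "g \<notin> N0"
    and "\<And>N. N \<lhd> G \<Longrightarrow> finite (rcosets N) \<Longrightarrow> g \<notin> N \<Longrightarrow> B \<le> card (rcosets N)"
  shows "B \<le> normal_depth G g"
proof -
  have "\<exists>N. N \<lhd> G \<and> finite (rcosets N) \<and> g \<notin> N \<and> normal_depth G g = card (rcosets N)"
    unfolding normal_depth_def by (rule LeastI_ex) (use ex in blast)
  then show ?thesis using assms(4) by auto
qed

end

lemma rf_growth_le:
  assumes "\<And>g. g \<in> word_ball G S n \<Longrightarrow> g \<noteq> \<one>\<^bsub>G\<^esub> \<Longrightarrow> normal_depth G g \<le> B"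
  shows "rf_growth G S n \<le> B"
proof (cases "word_ball G S n - {\<one>\<^bsub>G\<^esub>} = {}")
  case True
  then show ?thesis by (simp add: rf_growth_def Sup_nat_def)
next
  case False
  then show ?thesis unfolding rf_growth_def by (intro cSUP_least) (use assms in auto)
qed

text \<open>\<open>Sup\<close> on the naturals dominates the members of a bounded set only.
  Boundedness is taken from a depth estimate rather than from finiteness of the ball.\<close>

lemma rf_growth_ge:
  assumes "\<And>g. g \<in> word_ball G S n \<Longrightarrow> g \<noteq> \<one>\<^bsub>G\<^esub> \<Longrightarrow> normal_depth G g \<le> B"
    and "g \<in> word_ball G S n" "g \<noteq> \<one>\<^bsub>G\<^esub>"
  shows "normal_depth G g \<le> rf_growth G S n"
  unfolding rf_growth_def
  by (rule cSUP_upper) (use assms in \<open>auto intro!: bdd_aboveI [of _ B]\<close>)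

section \<open>The group of affine maps\<close>

type_synonym point = "nat \<times> (int \<Rightarrow> bit) \<times> bit"

context pulses
begin

text \<open>Normal form of the group elements: \<open>s\<close> is the power of the shift,
  \<open>v\<close> and \<open>w\<close> are the supports of products of conjugates of
  \<open>a\<close> and of \<open>b\<close>, and \<open>z\<close> holds the central values, one per
  level. The set \<open>w\<close> reads the old \<open>f\<close>, before shift and pulses are
  applied.\<close>

definition aff :: "int \<Rightarrow> int set \<Rightarrow> int set \<Rightarrow> (nat \<Rightarrow> bit) \<Rightarrow> point \<Rightarrow> point" where
  "aff s v w z = (\<lambda>(l, f, e). (l, \<lambda>p. f (p + s) + (\<Sum>j\<in>v. pulse l (p + j)), e + (\<Sum>k\<in>w. f k) + z l))"

text \<open>The right factor acts first, so \<open>w\<close> reads \<open>f\<close> after the pulses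
  of \<open>v'\<close> have been added. The double sum records this; it is the cocycle of a central
  extension of Heisenberg type.\<close>

lemma aff_comp:
  assumes "finite v" "finite v'" "finite w" "finite w'"
  shows "aff s v w z \<circ> aff s' v' w' z' =
    aff (s + s') (sym_diff v ((+) s ` v')) (sym_diff w' ((+) s' ` w))
      (\<lambda>l. z l + z' l + (\<Sum>k\<in>w. \<Sum>j\<in>v'. pulse l (k + j)))"
proof
  fix x :: point
  obtain l f e where x: "x = (l, f, e)" by (cases x)
  have v: "(\<Sum>j\<in>sym_diff v ((+) s ` v'). pulse l (p + j)) =
      (\<Sum>j\<in>v. pulse l (p + j)) + (\<Sum>j\<in>v'. pulse l (p + s + j))" for p
    using assms by (simp add: sum_sym_diff_bit sum.reindex ac_simps)
  have w: "(\<Sum>k\<in>sym_diff w' ((+) s' ` w). f k) = (\<Sum>k\<in>w'. f k) + (\<Sum>k\<in>w. f (k + s'))"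
    using assms by (simp add: sum_sym_diff_bit sum.reindex ac_simps)
  show "(aff s v w z \<circ> aff s' v' w' z') x =
    aff (s + s') (sym_diff v ((+) s ` v')) (sym_diff w' ((+) s' ` w))
      (\<lambda>l. z l + z' l + (\<Sum>k\<in>w. \<Sum>j\<in>v'. pulse l (k + j))) x"
    unfolding x aff_def comp_apply prod.case v w sum.distrib by (simp only: add_ac)
qed

lemma aff_id: "aff 0 {} {} (\<lambda>_. 0) = id"
  by (auto simp: aff_def fun_eq_iff)

end

text \<open>The group is kept abstract, with a faithful action by maps, so that its elements need
  not be maps themselves and the carrier type stays free.\<close>

locale lamp_action = pulses A \<kappa> + group G
  for A \<kappa> and G (structure) +
  fixes act :: "'a \<Rightarrow> point \<Rightarrow> point" and a b t :: 'a
  assumes act_one: "act \<one> = id"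
    and act_mult: "x \<in> carrier G \<Longrightarrow> y \<in> carrier G \<Longrightarrow> act (x \<otimes> y) = act x \<circ> act y"
    and act_inj: "inj_on act (carrier G)"
    and gens_closed [simp]: "a \<in> carrier G" "b \<in> carrier G" "t \<in> carrier G"
    and act_a: "act a = aff 0 {0} {} (\<lambda>_. 0)"
    and act_b: "act b = aff 0 {} {0} (\<lambda>_. 0)"
    and act_t: "act t = aff 1 {} {} (\<lambda>_. 0)"
    and generate_gens: "generate G {a, b, t} = carrier G"

text \<open>The three bijections generate a countable group of maps. A numbering carries its
  structure to the natural numbers, and the inverse of the numbering is the action.\<close>

lemma (in pulses) lamp_action_exists:
  "\<exists>(G :: nat monoid) act a b t. lamp_action A \<kappa> G act a b t"
proof -
  define P :: "(point \<Rightarrow> point) monoid" where "P = \<lparr>carrier = {f. bij f}, mult = (\<circ>), one = id\<rparr>"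
  have P: "group P"
  proof (rule groupI)
    fix x assume "x \<in> carrier P"
    then show "\<exists>y\<in>carrier P. y \<otimes>\<^bsub>P\<^esub> x = \<one>\<^bsub>P\<^esub>"
      by (intro bexI [of _ "inv_into UNIV x"]) (auto simp: P_def bij_imp_bij_inv bij_is_inj)
  qed (auto simp: P_def bij_comp comp_assoc)
  interpret P: group P by (rule P)
  define \<alpha> where "\<alpha> = aff 0 {0} {} (\<lambda>_. 0)"
  define \<beta> where "\<beta> = aff 0 {} {0} (\<lambda>_. 0)"
  define \<tau> where "\<tau> = aff 1 {} {} (\<lambda>_. 0)"
  have "\<alpha> \<circ> \<alpha> = id" "\<beta> \<circ> \<beta> = id" "\<tau> \<circ> aff (- 1) {} {} (\<lambda>_. 0) = id" "aff (- 1) {} {} (\<lambda>_. 0) \<circ> \<tau> = id"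
    by (simp_all add: \<alpha>_def \<beta>_def \<tau>_def aff_comp aff_id)
  then have "bij \<alpha>" "bij \<beta>" "bij \<tau>" by (blast intro: o_bij)+
  then have S: "{\<alpha>, \<beta>, \<tau>} \<subseteq> carrier P" by (simp add: P_def)
  define M where "M = generate P {\<alpha>, \<beta>, \<tau>}"
  define H where "H = P\<lparr>carrier := M\<rparr>"
  have M: "subgroup M P" unfolding M_def by (rule P.generate_is_subgroup [OF S])
  have H: "group H" unfolding H_def using P.subgroup_imp_group [OF M] .
  have SM: "{\<alpha>, \<beta>, \<tau>} \<subseteq> M" unfolding M_def using generate.incl [of _ "{\<alpha>, \<beta>, \<tau>}" P] by blast
  have genH: "generate H {\<alpha>, \<beta>, \<tau>} = carrier H"
    unfolding H_def using P.generate_consistent [OF SM M] by (simp add: M_def)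
  have carH: "carrier H = M" by (simp add: H_def)
  have cnt: "countable M" unfolding M_def by (rule P.countable_generate [OF S]) simp
  define h where "h = to_nat_on M"
  have inj: "inj_on h (carrier H)" unfolding h_def carH using cnt by (rule inj_on_to_nat_on)
  define G where "G = image_group h H"
  have G: "group G" unfolding G_def by (rule group.inj_imp_image_group_is_group [OF H inj])
  have hom: "h \<in> hom H G" using inj_imp_image_group_iso [OF inj] unfolding G_def iso_def by blast
  interpret gh: group_hom H G h
    by (intro group_hom.intro group_hom_axioms.intro H G hom)
  have carG: "carrier G = h ` carrier H" unfolding G_def by (rule image_group_carrier)
  define act where "act = inv_into (carrier H) h"
  have act_h: "act (h x) = x" if "x \<in> carrier H" for x
    unfolding act_def using inj that by (rule inv_into_f_f)
  have SH: "{\<alpha>, \<beta>, \<tau>} \<subseteq> carrier H" using SM by (simp add: H_def)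
  have oneH: "\<one>\<^bsub>H\<^esub> = id" and multH: "x \<otimes>\<^bsub>H\<^esub> y = x \<circ> y" for x y by (simp_all add: H_def P_def)
  interpret G: group G by (rule G)
  have "lamp_action A \<kappa> G act (h \<alpha>) (h \<beta>) (h \<tau>)"
  proof
    show "act \<one>\<^bsub>G\<^esub> = id" unfolding gh.hom_one [symmetric] using act_h [OF gh.G.one_closed] oneH by (rule trans)
    show "act (x \<otimes>\<^bsub>G\<^esub> y) = act x \<circ> act y" if xy: "x \<in> carrier G" "y \<in> carrier G" for x y
    proof -
      obtain u v where uv: "u \<in> carrier H" "v \<in> carrier H" "x = h u" "y = h v"
        using xy unfolding carG by blast
      have "act (x \<otimes>\<^bsub>G\<^esub> y) = u \<otimes>\<^bsub>H\<^esub> v"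
        unfolding uv(3,4) gh.hom_mult [OF uv(1,2), symmetric]
        by (rule act_h) (rule gh.G.m_closed [OF uv(1,2)])
      then show ?thesis unfolding uv(3,4) multH act_h [OF uv(1)] act_h [OF uv(2)] .
    qed
    show "inj_on act (carrier G)" unfolding act_def carG by (rule inj_on_inv_into) simp
    show "h \<alpha> \<in> carrier G" "h \<beta> \<in> carrier G" "h \<tau> \<in> carrier G" using SH carG by auto
    show "act (h \<alpha>) = aff 0 {0} {} (\<lambda>_. 0)" "act (h \<beta>) = aff 0 {} {0} (\<lambda>_. 0)"
      "act (h \<tau>) = aff 1 {} {} (\<lambda>_. 0)"
      unfolding \<alpha>_def [symmetric] \<beta>_def [symmetric] \<tau>_def [symmetric] using SH by (auto intro: act_h)
    show "generate G {h \<alpha>, h \<beta>, h \<tau>} = carrier G"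
      using gh.generate_img [OF SH] genH carG by simp
  qed
  then show ?thesis by blast
qed

section \<open>Finite quotients\<close>

lemma abs_le_subsetD: "V \<subseteq> {- n..n} \<Longrightarrow> j \<in> V \<Longrightarrow> \<bar>j\<bar> \<le> n" for n :: int
  by (drule (1) subsetD) (auto simp: abs_le_iff)

context lamp_action
begin

abbreviation gens :: "'a set" where "gens \<equiv> {a, b, t}"

abbreviation zero_vec :: "nat \<Rightarrow> bit" ("\<zero>\<zero>") where "\<zero>\<zero> \<equiv> (\<lambda>_. 0)"

lemma gens_subset: "gens \<subseteq> carrier G"
  by simp

lemma act_eqD: "x \<in> carrier G \<Longrightarrow> y \<in> carrier G \<Longrightarrow> act x = act y \<Longrightarrow> x = y"
  using act_inj by (auto dest: inj_onD)

lemma act_inv_right: "x \<in> carrier G \<Longrightarrow> act x (act (inv x) p) = p"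
  using act_mult [of x "inv x"] by (simp add: act_one) (metis comp_apply id_apply)

lemma act_inv_left: "x \<in> carrier G \<Longrightarrow> act (inv x) (act x p) = p"
  using act_mult [of "inv x" x] by (simp add: act_one) (metis comp_apply id_apply)

lemma act_invI:
  assumes "x \<in> carrier G" "f \<circ> act x = id"
  shows "act (inv x) = f"
proof
  fix p
  have "f p = f (act x (act (inv x) p))" using act_inv_right [OF assms(1)] by simp
  also have "\<dots> = act (inv x) p" using assms(2) by (metis comp_apply id_apply)
  finally show "act (inv x) p = f p" by simp
qed

lemma act_inv_t: "act (inv t) = aff (- 1) {} {} \<zero>\<zero>"
  by (rule act_invI) (simp_all add: act_t aff_comp aff_id)

lemma inv_a: "inv a = a" and inv_b: "inv b = b"
proof -
  have "act (inv a) = act a" by (rule act_invI) (simp_all add: act_a aff_comp aff_id)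
  then show "inv a = a" by (intro act_eqD) simp_all
  have "act (inv b) = act b" by (rule act_invI) (simp_all add: act_b aff_comp aff_id)
  then show "inv b = b" by (intro act_eqD) simp_all
qed

text \<open>Each letter extends the range of \<open>s\<close>, \<open>v\<close> and \<open>w\<close>
  by at most one, so a word of length \<open>n\<close> meets pulses only within distance
  \<open>n\<close> of 0. This hides the high central coordinates from short words.\<close>

lemma word_ball_aff:
  assumes "x \<in> word_ball G gens n"
  shows "\<exists>s v w z. act x = aff s v w z \<and> \<bar>s\<bar> \<le> int n \<and> v \<subseteq> {- int n..int n} \<and> w \<subseteq> {- int n..int n} \<and>
    (\<forall>l. l \<notin> A \<or> n < 2 ^ \<kappa> l \<longrightarrow> z l = 0)"
  using gens_subset assms
proof (induction rule: word_ball_induct)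
  case (one n)
  show ?case by (intro exI [of _ 0] exI [of _ "{}"] exI [of _ "\<zero>\<zero>"]) (simp add: act_one aff_id)
next
  case (step x y n)
  then obtain s v w z where y: "act y = aff s v w z" and s: "\<bar>s\<bar> \<le> int n"
      and v: "v \<subseteq> {- int n..int n}" and w: "w \<subseteq> {- int n..int n}"
      and z: "\<And>l. l \<notin> A \<or> n < 2 ^ \<kappa> l \<Longrightarrow> z l = 0" by blast
  have fin: "finite v" "finite w" using v w by (auto intro: finite_subset)
  have xc: "x \<in> carrier G" using step(1) by auto
  have xy: "act (x \<otimes> y) = act x \<circ> act y" using act_mult xc step(2) by blast
  have x: "x = a \<or> x = b \<or> x = t \<or> x = inv t" using step(1) by (auto simp: inv_a inv_b)
  have nS: "n < 2 ^ \<kappa> l" if "Suc n < 2 ^ \<kappa> l" for l using that by simp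
  have z': "\<forall>l. l \<notin> A \<or> Suc n < 2 ^ \<kappa> l \<longrightarrow> z l = 0" using z nS by blast
  have v': "v \<subseteq> {- int (Suc n)..int (Suc n)}" and w': "w \<subseteq> {- int (Suc n)..int (Suc n)}"
    using v w by force+
  consider "x = a" | "x = b" | \<sigma> where "\<sigma> = 1 \<or> \<sigma> = - 1" "act x = aff \<sigma> {} {} \<zero>\<zero>"
    using x act_t act_inv_t by blast
  then show ?case
  proof cases
    case 1
    have "act (x \<otimes> y) = aff s (sym_diff {0} v) w z"
      unfolding xy unfolding 1 act_a y using fin by (simp add: aff_comp)
    moreover have "sym_diff {0} v \<subseteq> {- int (Suc n)..int (Suc n)}" using v' by auto
    moreover have "\<bar>s\<bar> \<le> int (Suc n)" using s by simp
    ultimately show ?thesis using w' z' by blast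
  next
    case 2
    \<comment> \<open>Only a letter \<open>b\<close> changes \<open>z\<close>, namely by the pulses
      at the points of \<open>v\<close>, and these points are too close to 0 for the levels in
      question.\<close>
    have pulse0: "(\<Sum>j\<in>v. pulse l j) = 0" if "l \<notin> A \<or> n < 2 ^ \<kappa> l" for l
    proof (rule sum.neutral, rule ballI)
      fix j assume "j \<in> v"
      then have j: "\<bar>j\<bar> \<le> int n" using v abs_le_subsetD by blast
      show "pulse l j = 0"
      proof (cases "l \<in> A")
        case True
        then have "int n < 2 ^ \<kappa> l" using that by (metis of_nat_less_iff of_nat_numeral of_nat_power)
        with j have "\<bar>j\<bar> < 2 ^ \<kappa> l" by (rule le_less_trans)
        then show ?thesis by (rule pulse_small)
      qed (simp add: pulse_def)
    qed
    have "act (x \<otimes> y) = aff s v (sym_diff w {s}) (\<lambda>l. z l + (\<Sum>j\<in>v. pulse l j))"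
      unfolding xy unfolding 2 act_b y using fin by (simp add: aff_comp)
    moreover have "sym_diff w {s} \<subseteq> {- int (Suc n)..int (Suc n)}" using w' s by auto
    moreover have "\<forall>l. l \<notin> A \<or> Suc n < 2 ^ \<kappa> l \<longrightarrow> z l + (\<Sum>j\<in>v. pulse l j) = 0"
    proof (intro allI impI)
      fix l assume "l \<notin> A \<or> Suc n < 2 ^ \<kappa> l"
      then have "l \<notin> A \<or> n < 2 ^ \<kappa> l" using nS by blast
      then show "z l + (\<Sum>j\<in>v. pulse l j) = 0" using z pulse0 by simp
    qed
    moreover have "\<bar>s\<bar> \<le> int (Suc n)" using s by simp
    ultimately show ?thesis using v' by blast
  next
    case (3 \<sigma>)
    have "act (x \<otimes> y) = aff (\<sigma> + s) ((+) \<sigma> ` v) w z"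
      unfolding xy unfolding 3 y using fin by (simp add: aff_comp)
    moreover have "(+) \<sigma> ` v \<subseteq> {- int (Suc n)..int (Suc n)}" using v 3(1) by fastforce
    moreover have "\<bar>\<sigma> + s\<bar> \<le> int (Suc n)" using s 3(1) by auto
    ultimately show ?thesis using w' z' by blast
  qed
qed

lemma act_aff:
  assumes "x \<in> carrier G"
  obtains s v w z where "act x = aff s v w z" "finite v" "finite w" "\<And>l. l \<notin> A \<Longrightarrow> z l = 0"
proof -
  obtain n where "x \<in> word_ball G gens n"
    using assms generate_word_ball [OF gens_subset] generate_gens by blast
  then show thesis using word_ball_aff [of x n] that by (meson finite_atLeastAtMost_int finite_subset)
qed

section \<open>The finite quotient at one level\<close>

definition periodic :: "nat \<Rightarrow> (int \<Rightarrow> bit) \<Rightarrow> bool" where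
  "periodic l f \<longleftrightarrow> (\<forall>p. f (p + 2 ^ l) = f p)"

text \<open>The functions of period \<open>2 ^ l\<close> at level \<open>l\<close> form an invariant
  set because the pulse has the same period; this is the kernel of the action there.\<close>

definition block_kernel :: "nat \<Rightarrow> 'a set" where
  "block_kernel l = {x \<in> carrier G. \<forall>f e. periodic l f \<longrightarrow> act x (l, f, e) = (l, f, e)}"

lemma periodic_mod:
  assumes "periodic l f"
  shows "f (p mod 2 ^ l) = f p"
proof -
  have "f (p + k * 2 ^ l) = f p" for p k
  proof (induction k rule: int_induct [where k = 0])
    case (step1 i)
    then show ?case using assms [unfolded periodic_def, rule_format, of "p + i * 2 ^ l"] by (simp add: algebra_simps)
  next
    case (step2 i)
    then show ?case using assms [unfolded periodic_def, rule_format, of "p + (i - 1) * 2 ^ l"] by (simp add: algebra_simps)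
  qed simp
  from this [of "p mod 2 ^ l" "p div 2 ^ l"] show ?thesis by (simp add: mod_div_mult_eq)
qed

lemma act_block:
  assumes "x \<in> carrier G" "periodic l f"
  obtains f' e' where "act x (l, f, e) = (l, f', e')" "periodic l f'"
proof -
  obtain s v w z where x: "act x = aff s v w z" by (rule act_aff [OF assms(1)])
  have "f (p + 2 ^ l + s) = f (p + s)" "pulse l (p + 2 ^ l + j) = pulse l (p + j)" for p j
    using assms(2) [unfolded periodic_def, rule_format, of "p + s"] pulse_period [of l "p + j"]
    by (simp_all add: ac_simps)
  then have "periodic l (\<lambda>p. f (p + s) + (\<Sum>j\<in>v. pulse l (p + j)))"
    unfolding periodic_def by simp
  then show thesis by (intro that) (auto simp: x aff_def)
qed

lemma block_kernel_normal: "block_kernel l \<lhd> G"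
proof -
  have "subgroup (block_kernel l) G"
  proof (rule subgroupI)
    show "block_kernel l \<noteq> {}" unfolding block_kernel_def using one_closed by (fastforce simp: act_one)
    show "inv x \<in> block_kernel l" if "x \<in> block_kernel l" for x
    proof -
      have x: "x \<in> carrier G" and fx: "\<And>f e. periodic l f \<Longrightarrow> act x (l, f, e) = (l, f, e)"
        using that by (simp_all add: block_kernel_def)
      have "act (inv x) (l, f, e) = (l, f, e)" if "periodic l f" for f e
        using act_inv_left [OF x, of "(l, f, e)"] fx [OF that] by simp
      then show ?thesis using x by (simp add: block_kernel_def)
    qed
    show "x \<otimes> y \<in> block_kernel l" if "x \<in> block_kernel l" "y \<in> block_kernel l" for x y
      using that unfolding block_kernel_def by (auto simp: act_mult)
  qed (auto simp: block_kernel_def)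
  moreover have "x \<otimes> h \<otimes> inv x \<in> block_kernel l" if x: "x \<in> carrier G" and h: "h \<in> block_kernel l" for x h
  proof -
    have hc: "h \<in> carrier G" using h by (simp add: block_kernel_def)
    have "act (x \<otimes> h \<otimes> inv x) (l, f, e) = (l, f, e)" if per: "periodic l f" for f e
    proof -
      obtain f' e' where q: "act (inv x) (l, f, e) = (l, f', e')" "periodic l f'"
        using act_block [OF inv_closed [OF x] per] by blast
      then have "act h (l, f', e') = (l, f', e')" using h by (simp add: block_kernel_def)
      then show ?thesis using x hc q act_inv_right [OF x, of "(l, f, e)"] by (simp add: act_mult)
    qed
    then show ?thesis using x hc by (simp add: block_kernel_def)
  qed
  ultimately show ?thesis unfolding normal_inv_iff by blast
qed

text \<open>On functions of period \<open>2 ^ l\<close> only four data matter: the shift modulo 2^l,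
  the added function on one period, the parity of \<open>w\<close> in each residue class, and one
  bit.\<close>

lemma block_key_exists:
  assumes "x \<in> carrier G"
  shows "\<exists>s h c e0. s \<in> {0..<2 ^ l} \<and> h \<subseteq> {0..<2 ^ l} \<and> c \<subseteq> {0..<2 ^ l} \<and>
    (\<forall>f e. periodic l f \<longrightarrow>
      act x (l, f, e) = (l, \<lambda>p. f (p + s) + of_bool (p mod 2 ^ l \<in> h), e + (\<Sum>k\<in>c. f k) + e0))"
proof -
  obtain s v w z where x: "act x = aff s v w z" and fin: "finite v" "finite w"
    by (rule act_aff [OF assms])
  define H where "H p = (\<Sum>j\<in>v. pulse l (p + j))" for p
  have "pulse l (p + 2 ^ l + j) = pulse l (p + j)" for p j
    using pulse_period [of l "p + j"] by (simp add: ac_simps)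
  then have "periodic l H" by (simp add: periodic_def H_def)
  note Hmod = periodic_mod [OF this]
  define h where "h = {p \<in> {0..<2 ^ l}. H p = 1}"
  have H: "H p = of_bool (p mod 2 ^ l \<in> h)" for p
    using Hmod [of p] by (cases "H p") (auto simp: h_def)
  define N where "N q = (\<Sum>k\<in>{k\<in>w. k mod 2 ^ l = q}. 1 :: bit)" for q :: int
  define c where "c = {q \<in> {0..<2 ^ l}. N q = 1}"
  have sum_c: "(\<Sum>k\<in>w. f k) = (\<Sum>k\<in>c. f k)" if "periodic l f" for f
  proof -
    have "(\<Sum>k\<in>w. f k) = (\<Sum>k\<in>w. f (k mod 2 ^ l))"
      using periodic_mod [OF that] by simp
    also have "\<dots> = (\<Sum>q\<in>{0..<2 ^ l}. \<Sum>k\<in>{k\<in>w. k mod 2 ^ l = q}. f (k mod 2 ^ l))"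
      using fin by (intro sum.group [symmetric]) auto
    also have "\<dots> = (\<Sum>q\<in>{0..<2 ^ l}. N q * f q)"
      by (intro sum.cong refl) (auto simp: N_def sum_distrib_right)
    also have "\<dots> = (\<Sum>q\<in>c. N q * f q)"
      by (rule sum.mono_neutral_right) (auto simp: c_def bit_not_zero_iff)
    also have "\<dots> = (\<Sum>q\<in>c. f q)"
      by (intro sum.cong refl) (auto simp: c_def)
    finally show ?thesis .
  qed
  have shift: "f (p + s) = f (p + s mod 2 ^ l)" if "periodic l f" for f p
    using periodic_mod [OF that, of "p + s"] periodic_mod [OF that, of "p + s mod 2 ^ l"]
    by (simp add: mod_add_right_eq)
  have "act x (l, f, e) = (l, \<lambda>p. f (p + s mod 2 ^ l) + of_bool (p mod 2 ^ l \<in> h), e + (\<Sum>k\<in>c. f k) + z l)"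
    if per: "periodic l f" for f e
    unfolding x aff_def prod.case H_def [symmetric] H sum_c [OF per] shift [OF per] ..
  then show ?thesis
    by (intro exI [of _ "s mod 2 ^ l"] exI [of _ h] exI [of _ c] exI [of _ "z l"]) (auto simp: h_def c_def)
qed

lemma block_kernel_index:
  "finite (rcosets (block_kernel l))" "card (rcosets (block_kernel l)) \<le> 2 * 2 ^ l * 4 ^ (2 ^ l)"
proof -
  define M :: "int set" where "M = {0..<2 ^ l}"
  define K :: "(int \<times> int set \<times> int set \<times> bit) set" where "K = M \<times> Pow M \<times> Pow M \<times> UNIV"
  define good where "good x k \<longleftrightarrow> k \<in> K \<and> (case k of (s, h, c, e0) \<Rightarrow> \<forall>f e. periodic l f \<longrightarrow>
      act x (l, f, e) = (l, \<lambda>p. f (p + s) + of_bool (p mod 2 ^ l \<in> h), e + (\<Sum>k\<in>c. f k) + e0))" for x k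
  \<comment> \<open>The data of an element need not be unique. Any choice suffices, since equal data
    force equal actions on the level.\<close>
  define key where "key x = (SOME k. good x k)" for x
  have key: "good x (key x)" if x: "x \<in> carrier G" for x
  proof -
    obtain s h c e0 where "s \<in> M" "h \<subseteq> M" "c \<subseteq> M"
      "\<forall>f e. periodic l f \<longrightarrow>
        act x (l, f, e) = (l, \<lambda>p. f (p + s) + of_bool (p mod 2 ^ l \<in> h), e + (\<Sum>k\<in>c. f k) + e0)"
      using block_key_exists [OF x, of l] unfolding M_def by blast
    then have "good x (s, h, c, e0)" unfolding good_def K_def by simp
    then show ?thesis unfolding key_def by (rule someI)
  qed
  have UNIV_bit: "(UNIV :: bit set) = {0, 1}" by (auto intro: bit.exhaust)
  have fin: "finite K" unfolding K_def M_def UNIV_bit by simp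
  have M: "finite M" "card M = 2 ^ l" by (simp_all add: M_def nat_power_eq)
  have four: "(2 :: nat) ^ N * 2 ^ N = 4 ^ N" for N using power_mult_distrib [of "2 :: nat" 2 N] by simp
  have "card K = card M * ((2 ^ card M * 2 ^ card M) * 2)"
    unfolding K_def UNIV_bit using M(1) by (simp add: card_cartesian_product card_Pow)
  then have cardK: "card K = 2 * 2 ^ l * 4 ^ (2 ^ l)"
    unfolding M(2) four by simp
  have sub: "subgroup (block_kernel l) G"
    using block_kernel_normal by (rule normal_imp_subgroup)
  have eq: "x \<otimes> inv y \<in> block_kernel l" if x: "x \<in> carrier G" and y: "y \<in> carrier G" and k: "key x = key y" for x y
  proof -
    have same: "act x (l, f, e) = act y (l, f, e)" if "periodic l f" for f e
    proof -
      obtain s h c e0 where ky: "key y = (s, h, c, e0)" by (cases "key y")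
      show ?thesis using key [OF x] key [OF y] that unfolding k ky good_def by simp
    qed
    have "act (x \<otimes> inv y) (l, f, e) = (l, f, e)" if per: "periodic l f" for f e
    proof -
      obtain f' e' where q: "act (inv y) (l, f, e) = (l, f', e')" "periodic l f'"
        using act_block [OF inv_closed [OF y] per] by blast
      then show ?thesis using x y same [OF q(2), of e'] act_inv_right [OF y, of "(l, f, e)"]
        by (simp add: act_mult)
    qed
    then show ?thesis using x y by (simp add: block_kernel_def)
  qed
  have keyK: "key x \<in> K" if "x \<in> carrier G" for x using key [OF that] by (simp add: good_def)
  show "finite (rcosets (block_kernel l))"
    by (rule rcosets_card_le(1) [OF sub fin keyK eq])
  show "card (rcosets (block_kernel l)) \<le> 2 * 2 ^ l * 4 ^ (2 ^ l)"
    using rcosets_card_le(2) [OF sub fin keyK eq] unfolding cardK .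
qed

text \<open>The interval from -n to n injects modulo \<open>2 ^ l0\<close>, so triviality on level
  \<open>l0\<close> forces \<open>v\<close>, \<open>s\<close> and \<open>w\<close> to be trivial.
  What remains is central, and by \<open>word_ball_aff\<close> its coordinates can be nonzero only
  at levels with \<open>2 ^ \<kappa> l \<le> n\<close>, where triviality kills them too.\<close>

lemma nontrivial_on_block:
  assumes x: "x \<in> word_ball G gens n" "x \<noteq> \<one>" and l0: "l0 \<in> A" "2 * n < 2 ^ l0"
  shows "\<exists>l\<in>A. (l = l0 \<or> 2 ^ \<kappa> l \<le> n) \<and> x \<notin> block_kernel l"
proof (rule ccontr)
  assume neg: "\<not> ?thesis"
  obtain s v w z where act: "act x = aff s v w z" and s: "\<bar>s\<bar> \<le> int n"
      and v: "v \<subseteq> {- int n..int n}" and w: "w \<subseteq> {- int n..int n}"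
      and z: "\<And>l. l \<notin> A \<or> n < 2 ^ \<kappa> l \<Longrightarrow> z l = 0"
    using word_ball_aff [OF x(1)] by blast
  have fin: "finite v" "finite w" by (rule finite_subset [OF v], simp) (rule finite_subset [OF w], simp)
  have "int (2 * n) < int (2 ^ l0)" using l0(2) by (simp only: of_nat_less_iff)
  then have n: "2 * int n < 2 ^ l0" by simp
  have triv: "act x (l, f, e) = (l, f, e)" if "l \<in> A" "l = l0 \<or> 2 ^ \<kappa> l \<le> n" "periodic l f" for l f e
  proof -
    have "x \<in> block_kernel l" using neg that by blast
    then show ?thesis using that(3) unfolding block_kernel_def by blast
  qed
  have f0: "f (p + s) + (\<Sum>j\<in>v. pulse l0 (p + j)) = f p" "(\<Sum>k\<in>w. f k) + z l0 = 0" if "periodic l0 f" for f p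
  proof -
    have eq: "(\<lambda>p. f (p + s) + (\<Sum>j\<in>v. pulse l0 (p + j))) = f" "0 + (\<Sum>k\<in>w. f k) + z l0 = 0"
      using triv [OF l0(1) _ that, of 0] unfolding act aff_def prod.case prod.inject by blast+
    then show "f (p + s) + (\<Sum>j\<in>v. pulse l0 (p + j)) = f p" "(\<Sum>k\<in>w. f k) + z l0 = 0"
      using fun_cong [OF eq(1), of p] eq(2) by simp_all
  qed
  have "periodic l0 (\<lambda>_. 0)" by (simp add: periodic_def)
  note zero = f0 [OF this]
  have z0: "z l0 = 0" using zero(2) by simp
  have per: "periodic l0 (\<lambda>p. of_bool (2 ^ l0 dvd p - k))" for k
  proof -
    have "p + 2 ^ l0 - k = (p - k) + 2 ^ l0" for p by simp
    then show ?thesis unfolding periodic_def by (simp only: dvd_add_triv_right_iff) simp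
  qed
  have close: "j = k" if "2 ^ l0 dvd j - k" "\<bar>j\<bar> \<le> int n" "\<bar>k\<bar> \<le> int n" for j k
  proof -
    have "\<bar>j - k\<bar> < 2 ^ l0" using that(2,3) n by linarith
    then show ?thesis using dvd_small_int [OF that(1)] by simp
  qed
  have vempty: "v = {}"
  proof (rule ccontr)
    assume "v \<noteq> {}"
    then obtain j0 where j0: "j0 \<in> v" by blast
    \<comment> \<open>The argument is chosen so that the pulse shifted by \<open>j0\<close> is met
      and no other one is.\<close>
    have "(\<Sum>j\<in>v. pulse l0 (2 ^ \<kappa> l0 - j0 + j)) = 1"
      unfolding pulse_def
    proof (rule sum_of_bool_eq_one [OF fin(1) j0])
      fix j assume "j \<in> v"
      then have b: "\<bar>j\<bar> \<le> int n" "\<bar>j0\<bar> \<le> int n" using v j0 abs_le_subsetD by blast+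
      have "2 ^ \<kappa> l0 - j0 + j - 2 ^ \<kappa> l0 = j - j0" by simp
      then show "l0 \<in> A \<and> 2 ^ l0 dvd 2 ^ \<kappa> l0 - j0 + j - 2 ^ \<kappa> l0 \<longleftrightarrow> j = j0"
        using close [OF _ b] l0(1) by auto
    qed
    then show False using zero(1) [of "2 ^ \<kappa> l0 - j0"] by simp
  qed
  \<comment> \<open>The indicator of the multiples of \<open>2 ^ l0\<close> detects the shift; its
    translate to \<open>k0\<close> detects a member of \<open>w\<close> below.\<close>
  have "of_bool (2 ^ l0 dvd 0 + s - 0) = (of_bool (2 ^ l0 dvd 0 - (0::int)) :: bit)"
    using f0(1) [OF per [of 0], of 0] vempty by simp
  then have s0: "s = 0" using close [of s 0] s by simp
  have wempty: "w = {}"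
  proof (rule ccontr)
    assume "w \<noteq> {}"
    then obtain k0 where k0: "k0 \<in> w" by blast
    have "(\<Sum>k\<in>w. of_bool (2 ^ l0 dvd k - k0) :: bit) = 1"
    proof (rule sum_of_bool_eq_one [OF fin(2) k0])
      fix k assume "k \<in> w"
      then have b: "\<bar>k\<bar> \<le> int n" "\<bar>k0\<bar> \<le> int n" using w k0 abs_le_subsetD by blast+
      then show "2 ^ l0 dvd k - k0 \<longleftrightarrow> k = k0" using close [OF _ b] by auto
    qed
    then show False using f0(2) [OF per [of k0]] z0 by simp
  qed
  have "z l = 0" for l
  proof (cases "l \<notin> A \<or> n < 2 ^ \<kappa> l")
    case False
    have "periodic l (\<lambda>_. 0)" by (simp add: periodic_def)
    from triv [OF _ _ this, of 0] False show ?thesis by (simp add: act aff_def vempty wempty)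
  qed (rule z)
  then have "z = \<zero>\<zero>" by auto
  then have "act x = act \<one>" by (simp add: act vempty wempty s0 aff_id act_one)
  then have "x = \<one>"
    using act_eqD x(1) word_ball_subset_carrier [OF gens_subset] by blast
  then show False using x(2) by simp
qed

lemma normal_depth_upper:
  assumes x: "x \<in> word_ball G gens n" "x \<noteq> \<one>" and l0: "l0 \<in> A" "2 * n < 2 ^ l0"
    and bound: "\<And>l. l \<in> A \<Longrightarrow> 2 ^ \<kappa> l \<le> n \<Longrightarrow> l \<le> l0"
  shows "normal_depth G x \<le> 2 * 2 ^ l0 * 4 ^ (2 ^ l0)"
proof -
  obtain l where l: "l \<in> A" "l = l0 \<or> 2 ^ \<kappa> l \<le> n" "x \<notin> block_kernel l"
    using nontrivial_on_block [OF x l0] by blast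
  then have "l \<le> l0" using bound by auto
  then have "2 * 2 ^ l * 4 ^ (2 ^ l) \<le> (2 * 2 ^ l0 * 4 ^ (2 ^ l0) :: nat)"
    by (intro mult_mono power_increasing) auto
  then show ?thesis
    using normal_depth_le [OF block_kernel_normal block_kernel_index(1) l(3)] block_kernel_index(2) [of l]
    by (meson le_trans)
qed

lemma residually_finite_G:
  assumes inf: "\<And>m. \<exists>l\<in>A. m \<le> l"
  shows "residually_finite G"
  unfolding residually_finite_def
proof (intro ballI impI)
  fix x assume x: "x \<in> carrier G" "x \<noteq> \<one>"
  obtain n where n: "x \<in> word_ball G gens n"
    using x(1) generate_word_ball [OF gens_subset] generate_gens by blast
  obtain l0 where l0: "l0 \<in> A" "2 * n \<le> l0" using inf by blast
  have "2 * n < 2 ^ l0" using l0(2) less_exp [of l0] by linarith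
  then obtain l where "x \<notin> block_kernel l" using nontrivial_on_block [OF n x(2) l0(1)] by blast
  then show "\<exists>H. subgroup H G \<and> finite (rcosets H) \<and> x \<notin> H"
    using block_kernel_index(1) block_kernel_normal normal_imp_subgroup by blast
qed

end

section \<open>Normal subgroups that miss a central involution\<close>

context lamp_action
begin

section \<open>Shifts and lamp configurations as group elements\<close>

lemma shift_in_word_ball:
  "\<exists>x\<in>word_ball G gens r. act x = aff (int r) {} {} \<zero>\<zero>"
  "\<exists>x\<in>word_ball G gens r. act x = aff (- int r) {} {} \<zero>\<zero>"
proof -
  have step: "\<exists>x\<in>word_ball G gens r. act x = aff (int r * \<sigma>) {} {} \<zero>\<zero>"
    if s: "s \<in> gens \<union> m_inv G ` gens" "act s = aff \<sigma> {} {} \<zero>\<zero>" for s \<sigma>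
  proof (induction r)
    case 0
    show ?case using word_ball_one by (intro bexI [of _ \<one>]) (simp_all add: act_one aff_id)
  next
    case (Suc r)
    then obtain x where x: "x \<in> word_ball G gens r" "act x = aff (int r * \<sigma>) {} {} \<zero>\<zero>" by blast
    have sb: "s \<in> word_ball G gens 1" by (rule word_ball_gen [OF gens_subset s(1)])
    have car: "s \<in> carrier G" "x \<in> carrier G" using sb x(1) word_ball_subset_carrier [OF gens_subset] by blast+
    have "s \<otimes> x \<in> word_ball G gens (Suc r)"
      using word_ball_mult [OF gens_subset sb x(1)] by simp
    moreover have "act (s \<otimes> x) = aff (int (Suc r) * \<sigma>) {} {} \<zero>\<zero>"
      unfolding act_mult [OF car] s(2) x(2) by (simp add: aff_comp algebra_simps)
    ultimately show ?case by blast
  qed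
  show "\<exists>x\<in>word_ball G gens r. act x = aff (int r) {} {} \<zero>\<zero>"
    using step [of t 1] act_t by simp
  show "\<exists>x\<in>word_ball G gens r. act x = aff (- int r) {} {} \<zero>\<zero>"
    using step [of "inv t" "- 1"] act_inv_t by simp
qed

lemma shift_exists: "\<exists>x\<in>carrier G. act x = aff s {} {} \<zero>\<zero>"
proof (cases "0 \<le> s")
  case True
  then have "\<exists>x\<in>word_ball G gens (nat s). act x = aff s {} {} \<zero>\<zero>"
    using shift_in_word_ball(1) [of "nat s"] by simp
  then show ?thesis using word_ball_subset_carrier [OF gens_subset] by blast
next
  case False
  then have "\<exists>x\<in>word_ball G gens (nat (- s)). act x = aff s {} {} \<zero>\<zero>"
    using shift_in_word_ball(2) [of "nat (- s)"] by simp
  then show ?thesis using word_ball_subset_carrier [OF gens_subset] by blast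
qed

lemma lamp_a_exists: "\<exists>x\<in>carrier G. act x = aff 0 {j} {} \<zero>\<zero>"
proof -
  obtain x where x: "x \<in> carrier G" "act x = aff j {} {} \<zero>\<zero>" using shift_exists by blast
  obtain y where y: "y \<in> carrier G" "act y = aff (- j) {} {} \<zero>\<zero>" using shift_exists by blast
  have "act (x \<otimes> (a \<otimes> y)) = aff 0 {j} {} \<zero>\<zero>"
    using x(1) y(1) by (simp add: act_mult x(2) y(2) act_a aff_comp)
  then show ?thesis by (rule bexI) (use x(1) y(1) in simp)
qed

lemma lamp_b_exists: "\<exists>x\<in>carrier G. act x = aff 0 {} {k} \<zero>\<zero>"
proof -
  obtain x where x: "x \<in> carrier G" "act x = aff (- k) {} {} \<zero>\<zero>" using shift_exists by blast
  obtain y where y: "y \<in> carrier G" "act y = aff k {} {} \<zero>\<zero>" using shift_exists by blast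
  have "act (x \<otimes> (b \<otimes> y)) = aff 0 {} {k} \<zero>\<zero>"
    using x(1) y(1) by (simp add: act_mult x(2) y(2) act_b aff_comp)
  then show ?thesis by (rule bexI) (use x(1) y(1) in simp)
qed

lemma lamps_a_exist: "finite V \<Longrightarrow> \<exists>x\<in>carrier G. act x = aff 0 V {} \<zero>\<zero>"
proof (induction V rule: finite_induct)
  case empty
  show ?case by (rule bexI [of _ \<one>]) (simp_all add: act_one aff_id)
next
  case (insert j V)
  then obtain x where x: "x \<in> carrier G" "act x = aff 0 V {} \<zero>\<zero>" by blast
  obtain y where y: "y \<in> carrier G" "act y = aff 0 {j} {} \<zero>\<zero>" using lamp_a_exists by blast
  have "sym_diff {j} V = insert j V" using insert by blast
  then have "act (y \<otimes> x) = aff 0 (insert j V) {} \<zero>\<zero>"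
    unfolding act_mult [OF y(1) x(1)] x(2) y(2) using insert by (simp add: aff_comp)
  then show ?case by (rule bexI) (use x(1) y(1) in simp)
qed

lemma lamps_b_exist: "finite W \<Longrightarrow> \<exists>x\<in>carrier G. act x = aff 0 {} W \<zero>\<zero>"
proof (induction W rule: finite_induct)
  case empty
  show ?case by (rule bexI [of _ \<one>]) (simp_all add: act_one aff_id)
next
  case (insert k W)
  then obtain x where x: "x \<in> carrier G" "act x = aff 0 {} W \<zero>\<zero>" by blast
  obtain y where y: "y \<in> carrier G" "act y = aff 0 {} {k} \<zero>\<zero>" using lamp_b_exists by blast
  have "sym_diff W {k} = insert k W" using insert by blast
  then have "act (y \<otimes> x) = aff 0 {} (insert k W) \<zero>\<zero>"
    unfolding act_mult [OF y(1) x(1)] x(2) y(2) using insert by (simp add: aff_comp)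
  then show ?case by (rule bexI) (use x(1) y(1) in simp)
qed

lemma lamps_exist:
  assumes "finite V" "finite W"
  shows "\<exists>x\<in>carrier G. act x = aff 0 V W \<zero>\<zero>"
proof -
  obtain x where x: "x \<in> carrier G" "act x = aff 0 V {} \<zero>\<zero>" using lamps_a_exist [OF assms(1)] by blast
  obtain y where y: "y \<in> carrier G" "act y = aff 0 {} W \<zero>\<zero>" using lamps_b_exist [OF assms(2)] by blast
  have "act (x \<otimes> y) = aff 0 V W \<zero>\<zero>"
    unfolding act_mult [OF x(1) y(1)] x(2) y(2) using assms by (simp add: aff_comp)
  then show ?thesis by (rule bexI) (use x(1) y(1) in simp)
qed

text \<open>For r = \<open>2 ^ \<kappa> i\<close> let \<open>u\<close> be the product of the
  involutions b_r and \<open>a\<close>, a word of length 2r + 2. Its square is their commutator,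
  with value \<open>pulse l r\<close> at level \<open>l\<close>, and \<open>pulse_pow_kappa\<close>
  makes this the basis vector at \<open>i\<close>.\<close>

lemma central_in_word_ball:
  assumes i: "i \<in> A"
  shows "\<exists>x\<in>word_ball G gens (4 * 2 ^ \<kappa> i + 4). act x = aff 0 {} {} (\<lambda>l. of_bool (l = i))"
proof -
  define r :: nat where "r = 2 ^ \<kappa> i"
  obtain x where x: "x \<in> word_ball G gens r" "act x = aff (- int r) {} {} \<zero>\<zero>"
    using shift_in_word_ball(2) by blast
  obtain y where y: "y \<in> word_ball G gens r" "act y = aff (int r) {} {} \<zero>\<zero>"
    using shift_in_word_ball(1) by blast
  have ab: "a \<in> word_ball G gens 1" "b \<in> word_ball G gens 1"
    using word_ball_gen [OF gens_subset] by simp_all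
  have car: "x \<in> carrier G" "y \<in> carrier G"
    using x(1) y(1) word_ball_subset_carrier [OF gens_subset] by blast+
  define u where "u = (x \<otimes> (b \<otimes> y)) \<otimes> a"
  have "u \<in> word_ball G gens ((r + (1 + r)) + 1)"
    unfolding u_def by (intro word_ball_mult gens_subset x(1) y(1) ab)
  then have "u \<otimes> u \<in> word_ball G gens (((r + (1 + r)) + 1) + ((r + (1 + r)) + 1))"
    by (intro word_ball_mult gens_subset)
  moreover have "((r + (1 + r)) + 1) + ((r + (1 + r)) + 1) = 4 * 2 ^ \<kappa> i + 4" by (simp add: r_def)
  ultimately have ball: "u \<otimes> u \<in> word_ball G gens (4 * 2 ^ \<kappa> i + 4)" by (simp only:)
  have "act u = aff 0 {0} {int r} (\<lambda>l. pulse l (int r))"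
    unfolding u_def using car by (simp add: act_mult x(2) y(2) act_a act_b aff_comp)
  then have "act (u \<otimes> u) = aff 0 {} {} (\<lambda>l. pulse l (int r))"
    using car by (simp add: u_def act_mult [of "x \<otimes> (b \<otimes> y) \<otimes> a" "x \<otimes> (b \<otimes> y) \<otimes> a"] aff_comp)
  also have "(\<lambda>l. pulse l (int r)) = (\<lambda>l. of_bool (l = i))"
    using pulse_pow_kappa [OF i] by (simp add: r_def)
  finally show ?thesis using ball by blast
qed

lemma act_quotient:
  assumes "x \<in> carrier G" "y \<in> carrier G" "act x = f \<circ> act y"
  shows "act (x \<otimes> inv y) = f"
proof
  fix p
  have "act (x \<otimes> inv y) p = act x (act (inv y) p)" using assms(1,2) by (simp add: act_mult)
  also have "\<dots> = f p" unfolding assms(3) comp_apply act_inv_right [OF assms(2)] ..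
  finally show "act (x \<otimes> inv y) p = f p" .
qed

section \<open>Lower bound for the index of a normal subgroup\<close>

lemma commutator_mem:
  assumes N: "N \<lhd> G" and n: "n \<in> N" and y: "y \<in> carrier G"
  shows "(y \<otimes> n) \<otimes> inv (n \<otimes> y) \<in> N" "(n \<otimes> y) \<otimes> inv (y \<otimes> n) \<in> N"
proof -
  have sub: "subgroup N G" using N by (rule normal_imp_subgroup)
  have nc: "n \<in> carrier G" using n subgroup.subset [OF sub] by blast
  have conj: "y \<otimes> h \<otimes> inv y \<in> N" if "h \<in> N" for h
    using normal_inv_iff N that y by blast
  have "(y \<otimes> n) \<otimes> inv (n \<otimes> y) = (y \<otimes> n \<otimes> inv y) \<otimes> inv n"
    using nc y by (simp add: inv_mult_group m_assoc)
  then show "(y \<otimes> n) \<otimes> inv (n \<otimes> y) \<in> N"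
    using conj [OF n] n sub by (simp add: subgroup.m_closed subgroup.m_inv_closed)
  have "(n \<otimes> y) \<otimes> inv (y \<otimes> n) = n \<otimes> (y \<otimes> inv n \<otimes> inv y)"
    using nc y by (simp add: inv_mult_group m_assoc)
  then show "(n \<otimes> y) \<otimes> inv (y \<otimes> n) \<in> N"
    using conj [of "inv n"] n sub by (simp add: subgroup.m_closed subgroup.m_inv_closed)
qed

text \<open>The configurations (V, W) inside a window of length 2^i number 4^(2^i) and lie in
  distinct cosets. Otherwise \<open>N\<close> contains an element with nontrivial configuration; its
  commutators with lamps fill the space \<open>Z\<close> of central vectors of \<open>N\<close> with
  pulse sums, and \<open>basis_vector_mem\<close> then puts \<open>x\<close> into
  \<open>N\<close>.\<close>

lemma central_depth:
  assumes i: "i \<in> A" and x: "x \<in> carrier G" "act x = aff 0 {} {} (\<lambda>l. of_bool (l = i))"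
    and N: "N \<lhd> G" "finite (rcosets N)" "x \<notin> N"
  shows "4 ^ (2 ^ i) \<le> card (rcosets N)"
proof -
  have sub: "subgroup N G" using N(1) by (rule normal_imp_subgroup)
  have Ncar: "y \<in> carrier G" if "y \<in> N" for y using that subgroup.subset [OF sub] by blast
  define Z where "Z = {c. \<exists>y\<in>N. act y = aff 0 {} {} c}"
  have add: "(\<lambda>l. c l + c' l) \<in> Z" if cc: "c \<in> Z" "c' \<in> Z" for c c'
  proof -
    obtain y y' where y: "y \<in> N" "act y = aff 0 {} {} c" "y' \<in> N" "act y' = aff 0 {} {} c'"
      using cc unfolding Z_def by blast
    have "act (y \<otimes> y') = aff 0 {} {} (\<lambda>l. c l + c' l)"
      unfolding act_mult [OF Ncar [OF y(1)] Ncar [OF y(3)]] y by (simp add: aff_comp)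
    then show ?thesis using subgroup.m_closed [OF sub y(1,3)] unfolding Z_def by blast
  qed
  have notin: "(\<lambda>l. of_bool (l = i)) \<notin> Z"
  proof
    assume "(\<lambda>l. of_bool (l = i)) \<in> Z"
    then obtain y where "y \<in> N" "act y = act x" unfolding Z_def x(2) by blast
    then show False using act_eqD [OF Ncar x(1)] N(3) by blast
  qed
  have short: "U = {}" if "U \<subseteq> {0..<2 ^ i}" "\<And>d. (\<lambda>l. \<Sum>j\<in>U. pulse l (d + j)) \<in> Z" for U
    using basis_vector_mem [OF add _ that(1) i that(2)] notin by blast
  define M :: "int set" where "M = {0..<2 ^ i}"
  have M: "finite M" "card M = 2 ^ i" by (simp_all add: M_def nat_power_eq)
  define f where "f p = (SOME y. y \<in> carrier G \<and> act y = aff 0 (fst p) (snd p) \<zero>\<zero>)" for p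
  have f: "f (V, W) \<in> carrier G \<and> act (f (V, W)) = aff 0 V W \<zero>\<zero>" if "V \<subseteq> M" "W \<subseteq> M" for V W
  proof -
    have "finite V" "finite W" using that M(1) finite_subset by blast+
    from lamps_exist [OF this] have "\<exists>y. y \<in> carrier G \<and> act y = aff 0 (fst (V, W)) (snd (V, W)) \<zero>\<zero>"
      by auto
    from someI_ex [OF this] show ?thesis unfolding f_def by simp
  qed
  have sep: "V = V' \<and> W = W'"
    if VW: "V \<subseteq> M" "W \<subseteq> M" "V' \<subseteq> M" "W' \<subseteq> M" and mem: "f (V, W) \<otimes> inv (f (V', W')) \<in> N"
    for V W V' W'
  proof -
    define n where "n = f (V, W) \<otimes> inv (f (V', W'))"
    define U where "U = sym_diff V V'"
    define T where "T = sym_diff W W'"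
    \<comment> \<open>\<open>\<zeta>\<close> cancels the double sum that arises on composing with
      \<open>f (V', W')\<close>.\<close>
    define \<zeta> where "\<zeta> l = (\<Sum>k\<in>T. \<Sum>j\<in>V'. pulse l (k + j))" for l
    have fin: "finite V" "finite W" "finite V'" "finite W'" using VW M(1) finite_subset by blast+
    have UT: "U \<subseteq> M" "T \<subseteq> M" using VW by (auto simp: U_def T_def)
    have finUT: "finite U" "finite T" using UT M(1) finite_subset by blast+
    note fV = f [OF VW(1,2)] and fV' = f [OF VW(3,4)]
    have sd: "sym_diff U V' = V" "sym_diff W' T = W" by (auto simp: U_def T_def)
    have "aff 0 U T \<zeta> \<circ> aff 0 V' W' \<zero>\<zero> = aff 0 V W \<zero>\<zero>"
      using fin finUT by (simp add: aff_comp sd \<zeta>_def)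
    then have n: "act n = aff 0 U T \<zeta>"
      unfolding n_def using fV fV' by (intro act_quotient) simp_all
    have nN: "n \<in> N" using mem by (simp add: n_def)
    note nc = Ncar [OF nN]
    \<comment> \<open>The lamp b_d commutes with the \<open>T\<close> part of \<open>n\<close>, so
      this commutator depends on \<open>U\<close> alone; commuting with a_d below depends on
      \<open>T\<close> alone. In both cases \<open>\<zeta>\<close> cancels.\<close>
    have "(\<lambda>l. \<Sum>j\<in>U. pulse l (d + j)) \<in> Z" for d
    proof -
      obtain y where y: "y \<in> carrier G" "act y = aff 0 {} {d} \<zero>\<zero>" using lamp_b_exists by blast
      have "act (y \<otimes> n) = aff 0 {} {} (\<lambda>l. \<Sum>j\<in>U. pulse l (d + j)) \<circ> act (n \<otimes> y)"
        unfolding act_mult [OF y(1) nc] act_mult [OF nc y(1)] n y(2)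
        using finUT by (simp add: aff_comp Un_commute add.commute)
      from act_quotient [OF _ _ this] show ?thesis
        using commutator_mem(1) [OF N(1) nN y(1)] nc y(1) unfolding Z_def by (simp, blast)
    qed
    then have "U = {}" using short UT(1) unfolding M_def by blast
    have "(\<lambda>l. \<Sum>k\<in>T. pulse l (d + k)) \<in> Z" for d
    proof -
      obtain y where y: "y \<in> carrier G" "act y = aff 0 {d} {} \<zero>\<zero>" using lamp_a_exists by blast
      have "act (n \<otimes> y) = aff 0 {} {} (\<lambda>l. \<Sum>k\<in>T. pulse l (d + k)) \<circ> act (y \<otimes> n)"
        unfolding act_mult [OF y(1) nc] act_mult [OF nc y(1)] n y(2)
        using finUT by (simp add: aff_comp Un_commute add.commute)
      from act_quotient [OF _ _ this] show ?thesis
        using commutator_mem(2) [OF N(1) nN y(1)] nc y(1) unfolding Z_def by (simp, blast)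
    qed
    then have "T = {}" using short UT(2) unfolding M_def by blast
    with \<open>U = {}\<close> show ?thesis unfolding U_def T_def by blast
  qed
  have "card (Pow M \<times> Pow M) \<le> card (rcosets N)"
  proof (rule rcosets_card_ge [OF sub N(2), of _ f])
    show "f p \<in> carrier G" if "p \<in> Pow M \<times> Pow M" for p using that f by auto
    show "p = q" if "p \<in> Pow M \<times> Pow M" "q \<in> Pow M \<times> Pow M" "f p \<otimes> inv (f q) \<in> N" for p q
      using that sep by (cases p; cases q) auto
  qed
  moreover have "card (Pow M \<times> Pow M) = 2 ^ 2 ^ i * 2 ^ 2 ^ i"
    using M by (simp add: card_cartesian_product card_Pow)
  moreover have "(2 :: nat) ^ 2 ^ i * 2 ^ 2 ^ i = 4 ^ 2 ^ i"
    using power_mult_distrib [of "2 :: nat" 2 "2 ^ i"] by simp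
  ultimately show ?thesis by simp
qed

lemma rf_growth_lower:
  assumes i: "i \<in> A" "4 * 2 ^ \<kappa> i + 4 \<le> n"
    and bound: "\<And>x. x \<in> word_ball G gens n \<Longrightarrow> x \<noteq> \<one> \<Longrightarrow> normal_depth G x \<le> B"
  shows "4 ^ (2 ^ i) \<le> rf_growth G gens n"
proof -
  obtain x where x: "x \<in> word_ball G gens (4 * 2 ^ \<kappa> i + 4)" "act x = aff 0 {} {} (\<lambda>l. of_bool (l = i))"
    using central_in_word_ball [OF i(1)] by blast
  have xn: "x \<in> word_ball G gens n" using x(1) word_ball_mono [OF i(2)] by blast
  have xc: "x \<in> carrier G" using xn word_ball_subset_carrier [OF gens_subset] by blast
  have moved: "act x (i, \<lambda>_. 0, 0) = (i, \<lambda>_. 0, 1)" by (simp add: x(2) aff_def)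
  then have "x \<noteq> \<one>" using act_one by auto
  \<comment> \<open>This kernel supplies the finite-index normal subgroup missing \<open>x\<close>
    that \<open>normal_depth_ge\<close> asks for.\<close>
  have "x \<notin> block_kernel i"
  proof
    assume "x \<in> block_kernel i"
    then have "act x (i, \<lambda>_. 0, 0) = (i, \<lambda>_. 0, 0)" by (simp add: block_kernel_def periodic_def)
    with moved show False by simp
  qed
  then have "4 ^ (2 ^ i) \<le> normal_depth G x"
    using normal_depth_ge [OF block_kernel_normal block_kernel_index(1)] central_depth [OF i(1) xc x(2)] by blast
  also have "\<dots> \<le> rf_growth G gens n" by (rule rf_growth_ge [OF bound xn \<open>x \<noteq> \<one>\<close>])
  finally show ?thesis .
qed

end

section \<open>Growth estimates\<close>

text \<open>Both growth bounds along the sequence \<open>D * 2 ^ k\<close>. The hypothesis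
  \<open>large\<close> yields \<open>k + 2 \<le> e k\<close>, which is the gap of 2 required of
  \<open>\<kappa>\<close>.\<close>

lemma group_from_growth_function:
  fixes F :: "nat \<Rightarrow> nat" and D :: nat
  assumes mono: "mono F" and large: "\<And>k. 4 ^ (2 ^ Suc k) < F (D * 2 ^ k)"
  shows "\<exists>(G :: nat monoid) S. group G \<and> residually_finite G \<and> finite S \<and> S \<subseteq> carrier G \<and>
    generate G S = carrier G \<and> rf_growth G S 0 = 0 \<and>
    (\<forall>n k. 4 * 2 ^ k + 4 \<le> n \<longrightarrow> F (D * 2 ^ k) \<le> rf_growth G S n) \<and>
    (\<forall>n k. n \<le> 2 ^ k \<longrightarrow>
      real (rf_growth G S n) \<le> 4 * ln (real (F (D * 2 ^ k))) * (real (F (D * 2 ^ k)))\<^sup>2)"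
proof -
  define e where "e k = (LEAST e. F (D * 2 ^ k) \<le> 4 ^ (2 ^ e))" for k
  have e_upper: "F (D * 2 ^ k) \<le> 4 ^ (2 ^ e k)" for k
    unfolding e_def
  proof (rule LeastI)
    have "F (D * 2 ^ k) \<le> 2 ^ F (D * 2 ^ k)" using less_exp by (rule less_imp_le)
    also have "\<dots> \<le> 4 ^ (2 ^ F (D * 2 ^ k))"
      using power_increasing [OF less_imp_le [OF less_exp [of "F (D * 2 ^ k)"]], of "2 :: nat"]
        power_mono [of "2 :: nat" 4 "2 ^ F (D * 2 ^ k)"] by linarith
    finally show "F (D * 2 ^ k) \<le> 4 ^ (2 ^ F (D * 2 ^ k))" .
  qed
  have e_lower: "4 ^ (2 ^ d) < F (D * 2 ^ k)" if "d < e k" for d k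
    using not_less_Least that unfolding e_def by (metis not_le)
  have e_mono: "e j \<le> e k" if "j \<le> k" for j k
    unfolding e_def [of j]
  proof (rule Least_le)
    have "F (D * 2 ^ j) \<le> F (D * 2 ^ k)"
      by (rule monoD [OF mono]) (use that in \<open>simp add: power_increasing\<close>)
    then show "F (D * 2 ^ j) \<le> 4 ^ (2 ^ e k)" using e_upper [of k] by linarith
  qed
  have e_ge: "k + 2 \<le> e k" for k
  proof (rule ccontr)
    assume "\<not> k + 2 \<le> e k"
    then have "(4 :: nat) ^ (2 ^ e k) \<le> 4 ^ (2 ^ Suc k)" by (intro power_increasing) auto
    then show False using e_upper [of k] large [of k] by linarith
  qed
  define \<kappa> where "\<kappa> l = (LEAST k. e k = l)" for l
  have e_kappa: "e (\<kappa> l) = l" if "l \<in> range e" for l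
    unfolding \<kappa>_def by (rule LeastI_ex) (use that in auto)
  have kappa_e: "\<kappa> (e k) \<le> k" for k unfolding \<kappa>_def by (rule Least_le) simp
  interpret pulses "range e" \<kappa>
  proof
    show "\<kappa> l + 2 \<le> l" if "l \<in> range e" for l using e_ge [of "\<kappa> l"] e_kappa [OF that] by simp
    show "\<kappa> l < \<kappa> l'" if "l \<in> range e" "l' \<in> range e" "l < l'" for l l'
      using e_mono [of "\<kappa> l'" "\<kappa> l"] e_kappa [OF that(1)] e_kappa [OF that(2)] that(3) by linarith
  qed
  obtain G :: "nat monoid" and act a b t where "lamp_action (range e) \<kappa> G act a b t"
    using lamp_action_exists by blast
  then interpret lamp_action "range e" \<kappa> G act a b t .
  have depth: "normal_depth G x \<le> 2 * 2 ^ e k * 4 ^ (2 ^ e k)"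
    if x: "x \<in> word_ball G {a, b, t} n" "x \<noteq> \<one>\<^bsub>G\<^esub>" and n: "n \<le> 2 ^ k" for x n k
  proof (rule normal_depth_upper [OF x])
    show "e k \<in> range e" by simp
    have "(2 :: nat) ^ (k + 2) \<le> 2 ^ e k" by (rule power_increasing [OF e_ge]) simp
    then have "4 * (2 :: nat) ^ k \<le> 2 ^ e k" by (simp add: power_add)
    moreover have "(0 :: nat) < 2 ^ k" by simp
    ultimately show "2 * n < 2 ^ e k" using n by linarith
    show "l \<le> e k" if l: "l \<in> range e" "2 ^ \<kappa> l \<le> n" for l
    proof -
      have "(2 :: nat) ^ \<kappa> l \<le> 2 ^ k" using l(2) n by (rule le_trans)
      then have "\<kappa> l \<le> k" by simp
      then show ?thesis using e_mono e_kappa [OF l(1)] by metis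
    qed
  qed
  have rf: "residually_finite G"
  proof (rule residually_finite_G)
    show "\<exists>l\<in>range e. m \<le> l" for m using e_ge [of m] by (intro bexI [of _ "e m"]) auto
  qed
  have zero: "rf_growth G {a, b, t} 0 = 0"
    using rf_growth_le [of G "{a, b, t}" 0 0] by (simp add: word_ball_def)
  have lower: "F (D * 2 ^ k) \<le> rf_growth G {a, b, t} n" if n: "4 * 2 ^ k + 4 \<le> n" for n k
  proof -
    have "(2 :: nat) ^ \<kappa> (e k) \<le> 2 ^ k" by (rule power_increasing [OF kappa_e]) simp
    then have le: "4 * 2 ^ \<kappa> (e k) + 4 \<le> n" using n by linarith
    \<comment> \<open>The crude depth bound with exponent \<open>n\<close>, from n < 2^n, only
      ensures that the depths in the ball are bounded.\<close>
    have "4 ^ (2 ^ e k) \<le> rf_growth G {a, b, t} n"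
      using rf_growth_lower [OF _ le] depth [OF _ _ less_imp_le [OF less_exp [of n]]] by blast
    then show ?thesis using e_upper [of k] by linarith
  qed
  have upper: "real (rf_growth G {a, b, t} n) \<le> 4 * ln (real (F (D * 2 ^ k))) * (real (F (D * 2 ^ k)))\<^sup>2"
    if n: "n \<le> 2 ^ k" for n k
  proof -
    define Y where "Y = real (F (D * 2 ^ k))"
    obtain d where d: "e k = Suc d" using e_ge [of k] by (cases "e k") auto
    \<comment> \<open>Half of \<open>2 ^ e k\<close>: minimality of \<open>e k\<close> gives 4^m <
      Y, hence both 4^(2m) \<le> Y^2 and, as e \<le> 4, m \<le> ln Y. The depth bound equals 4 m
      4^(2m).\<close>
    define m :: nat where "m = 2 ^ d"
    have M: "2 ^ e k = 2 * m" by (simp add: d m_def)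
    have "real (4 ^ m) < Y" unfolding Y_def of_nat_less_iff m_def using e_lower [of d k] d by simp
    then have Y: "4 ^ m < Y" by simp
    have Y1: "1 \<le> Y" using Y one_le_power [of "4::real" m] by linarith
    have "(4 :: real) ^ (2 * m) = (4 ^ m)\<^sup>2" by (simp add: power_mult [symmetric] mult.commute)
    also have "\<dots> \<le> Y\<^sup>2" using Y by (intro power_mono) auto
    finally have Y2: "(4 :: real) ^ (2 * m) \<le> Y\<^sup>2" .
    have "exp (real m) = exp 1 ^ m" by (simp add: exp_of_nat_mult [symmetric])
    also have "\<dots> \<le> 4 ^ m" using exp_le by (intro power_mono) auto
    finally have "exp (real m) \<le> Y" using Y by linarith
    then have m: "real m \<le> ln Y" using Y1 by (simp add: ln_ge_iff)
    have "rf_growth G {a, b, t} n \<le> 2 * 2 ^ e k * 4 ^ (2 ^ e k)"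
      by (rule rf_growth_le) (rule depth [OF _ _ n])
    then have "real (rf_growth G {a, b, t} n) \<le> real (2 * (2 * m) * 4 ^ (2 * m))"
      unfolding M by (simp only: of_nat_le_iff)
    also have "\<dots> = (4 * real m) * 4 ^ (2 * m)" by simp
    also have "\<dots> \<le> (4 * ln Y) * Y\<^sup>2" using m Y2 by (intro mult_mono) auto
    finally show ?thesis by (simp add: Y_def)
  qed
  show ?thesis
    using group_axioms rf gens_subset generate_gens zero lower upper
    by (intro exI [of _ G] exI [of _ "{a, b, t}"]) simp
qed

section \<open>Estimates with the ratio of iterated logarithms\<close>

lemma iterated_log_ratio_nonneg: "0 \<le> iterated_log_ratio x"
proof (cases "exp (exp 1) \<le> x")
  case True
  have "0 < x" using True exp_gt_zero [of "exp 1"] by linarith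
  \<comment> \<open>The threshold is exactly where ln ln x reaches 1 and ln ln ln x reaches
    0.\<close>
  then have "exp 1 \<le> ln x" using True by (simp add: ln_ge_iff)
  moreover from this have "0 < ln x" using exp_gt_zero [of "1::real"] by linarith
  ultimately have "1 \<le> ln (ln x)" by (simp add: ln_ge_iff)
  then show ?thesis by (simp add: iterated_log_ratio_def)
qed (simp add: iterated_log_ratio_def)

text \<open>With y = ln Y the claim reduces to ln (4y) \<le> 12 R y for the ratio R at
  \<open>x\<close>. The lower bound on \<open>x\<close> makes ln ln ln x at least 1, so R is at
  least 1 / ln y. The constant is 3 times 4, from ln (4y) \<le> 3 ln y and (ln y)^2 \<le>
  4y.\<close>

lemma log_factor_absorbed:
  assumes x: "exp (exp (exp 1)) \<le> x" and xY: "x \<le> Y"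
  shows "4 * ln Y * Y\<^sup>2 \<le> Y powr (2 + 12 * iterated_log_ratio x)"
proof -
  have x0: "0 < x" using x exp_gt_zero [of "exp (exp 1)"] by linarith
  have Y0: "0 < Y" using x0 xY by linarith
  define y where "y = ln Y"
  have lnx: "exp (exp 1) \<le> ln x" using x x0 by (simp add: ln_ge_iff)
  have lnx0: "0 < ln x" using lnx exp_gt_zero [of "exp 1"] by linarith
  have xy: "ln x \<le> y" unfolding y_def using x0 xY by simp
  have y0: "0 < y" using lnx0 xy by linarith
  have llx: "exp 1 \<le> ln (ln x)" using lnx lnx0 by (simp add: ln_ge_iff)
  have llx1: "1 \<le> ln (ln x)" using llx exp_ge_add_one_self [of 1] by linarith
  have lly: "ln (ln x) \<le> ln y" using lnx0 xy by simp
  have ly1: "1 \<le> ln y" using llx1 lly by linarith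
  have lllx: "1 \<le> ln (ln (ln x))" using llx llx1 by (simp add: ln_ge_iff)
  have "(1::real) \<le> exp 1" by simp
  then have "exp (exp 1) \<le> exp (exp (exp (1::real)))" using exp_ge_add_one_self [of "exp (1::real)"] by simp
  then have "exp (exp 1) \<le> x" using x by linarith
  then have R: "iterated_log_ratio x = ln (ln (ln x)) / ln (ln x)"
    by (simp add: iterated_log_ratio_def)
  have R_ge: "1 / ln y \<le> iterated_log_ratio x"
    unfolding R using lllx llx1 lly by (intro frac_le) auto
  have "ln y = 2 * ln (sqrt y)" using y0 by (simp add: ln_sqrt)
  also have "\<dots> \<le> 2 * sqrt y" using y0 ln_le_minus_one [of "sqrt y"] by simp
  finally have "(ln y)\<^sup>2 \<le> (2 * sqrt y)\<^sup>2" using ly1 by (intro power_mono) auto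
  then have sq: "(ln y)\<^sup>2 \<le> 4 * y" using y0 by (simp add: power_mult_distrib)
  have "ln (4::real) \<le> 2"
    using ln_le_minus_one [of "2::real"] ln_mult [of "2::real" 2] by simp
  then have "ln (4 * y) \<le> 3 * ln y" using y0 ly1 by (simp add: ln_mult)
  also have "\<dots> \<le> 12 * (y / ln y)"
    using sq ly1 by (simp add: field_simps power2_eq_square)
  also have "\<dots> \<le> 12 * iterated_log_ratio x * y"
    using mult_right_mono [OF R_ge, of y] y0 by simp
  finally have "exp (ln (4 * y)) \<le> exp (12 * iterated_log_ratio x * y)" by simp
  then have "4 * y \<le> exp (12 * iterated_log_ratio x * y)" using y0 by simp
  then have "4 * y * Y\<^sup>2 \<le> exp (12 * iterated_log_ratio x * y) * Y\<^sup>2"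
    by (intro mult_right_mono) auto
  also have "\<dots> = Y powr (2 + 12 * iterated_log_ratio x)"
    using Y0 by (simp add: powr_add powr_def [of Y "12 * _"] y_def)
  finally show ?thesis by (simp add: y_def)
qed

theorem theorem3p9:
  fixes F :: "nat \<Rightarrow> nat"
  assumes "mono F"
    and "\<exists>c>0. \<exists>\<epsilon>>0. \<forall>n\<ge>3.
           real (F n) \<ge> exp (c * real n * (ln (real n))\<^sup>2 * (ln (ln (real n))) powr (1 + \<epsilon>))"
  shows "\<exists>(G :: nat monoid) (S :: nat set) (c1 :: real) (c2 :: real) (c3 :: real).
           group G \<and> residually_finite G \<and>
           finite S \<and> S \<subseteq> carrier G \<and> generate G S = carrier G \<and>
           c1 > 1 \<and> c2 > 1 \<and> c3 > 1 \<and>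
           (\<forall>n.
              (real n / c1 - c2 > 0 \<longrightarrow>
                 real (at_real F (real n / c1 - c2))
                   powr (1 - c3 * iterated_log_ratio (real (F n))) \<le> real (rf_growth G S n)) \<and>
              real (rf_growth G S n) \<le>
                real (at_real F (c1 * real n + c2))
                  powr (2 + c3 * iterated_log_ratio (real (F n))))"
proof -
  have F_mono: "F m \<le> F n" if "m \<le> n" for m n using assms(1) that by (rule monoD)
  obtain c \<epsilon> where c: "0 < c" and \<epsilon>: "0 < \<epsilon>"
    and F: "\<And>n. 3 \<le> n \<Longrightarrow> exp (c * real n * (ln (real n))\<^sup>2 * (ln (ln (real n))) powr (1 + \<epsilon>)) \<le> real (F n)"
    using assms(2) by blast
  \<comment> \<open>The logarithmic factors are frozen at their values at 4, which leaves an
    exponential lower bound of rate \<open>\<gamma>\<close>. Since e \<le> 3 < 4, ln ln 4 is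
    positive.\<close>
  define \<gamma> where "\<gamma> = c * (ln 4)\<^sup>2 * (ln (ln 4)) powr (1 + \<epsilon>)"
  have "ln (exp 1) < ln (4::real)" using exp_le by (subst ln_less_cancel_iff) auto
  then have ln4: "1 < ln (4::real)" by simp
  have \<gamma>: "0 < \<gamma>" unfolding \<gamma>_def using c ln4 by simp
  have F_exp: "exp (\<gamma> * real n) \<le> real (F n)" if n: "4 \<le> n" for n
  proof -
    have l: "ln 4 \<le> ln (real n)" using n by simp
    have l1: "0 < ln (ln (4::real))" using ln4 by simp
    have l2: "ln (ln 4) \<le> ln (ln (real n))" using l ln4 by simp
    have "(ln 4)\<^sup>2 * ln (ln 4) powr (1 + \<epsilon>) \<le> (ln (real n))\<^sup>2 * (ln (ln (real n))) powr (1 + \<epsilon>)"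
      using l ln4 l1 l2 \<epsilon> by (intro mult_mono power_mono powr_mono2) auto
    then have "(c * real n) * ((ln 4)\<^sup>2 * ln (ln 4) powr (1 + \<epsilon>)) \<le>
        (c * real n) * ((ln (real n))\<^sup>2 * (ln (ln (real n))) powr (1 + \<epsilon>))"
      using c by (intro mult_left_mono) auto
    then have "\<gamma> * real n \<le> c * real n * (ln (real n))\<^sup>2 * (ln (ln (real n))) powr (1 + \<epsilon>)"
      by (simp add: \<gamma>_def mult_ac)
    then have "exp (\<gamma> * real n) \<le> exp (c * real n * (ln (real n))\<^sup>2 * (ln (ln (real n))) powr (1 + \<epsilon>))"
      by simp
    also have "\<dots> \<le> real (F n)" by (rule F) (use n in simp)
    finally show ?thesis .
  qed
  \<comment> \<open>The quotient makes exp (\<gamma> D 2^k) beat 4^(2 * 2^k) = exp (2 ln 4 * 2^k).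
    The summand 4 makes this strict and keeps \<open>D * 2 ^ k\<close> in the range of
    \<open>F_exp\<close>.\<close>
  define D :: nat where "D = nat \<lceil>2 * ln 4 / \<gamma>\<rceil> + 4"
  have D: "2 * ln 4 < \<gamma> * real D"
  proof -
    have "2 * ln 4 / \<gamma> < real D" unfolding D_def using of_nat_ceiling [of "2 * ln 4 / \<gamma>"] by simp
    then show ?thesis using \<gamma> by (simp add: pos_divide_less_eq mult.commute)
  qed
  have D4: "4 \<le> D" by (simp add: D_def)
  have large: "4 ^ (2 ^ Suc k) < F (D * 2 ^ k)" for k
  proof -
    have "real (4 ^ (2 ^ Suc k)) = exp (ln 4) ^ (2 ^ Suc k)" by simp
    also have "\<dots> = exp (real (2 ^ Suc k) * ln 4)" by (rule exp_of_nat_mult [symmetric])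
    also have "\<dots> = exp (2 * ln 4 * 2 ^ k)" by (simp add: mult_ac)
    also have "\<dots> < exp (\<gamma> * real D * 2 ^ k)" using D by simp
    also have "\<dots> = exp (\<gamma> * real (D * 2 ^ k))" by (simp add: mult.assoc)
    also have "\<dots> \<le> real (F (D * 2 ^ k))"
    proof (rule F_exp)
      have "D * 1 \<le> D * 2 ^ k" by (intro mult_left_mono) simp_all
      then show "4 \<le> D * 2 ^ k" using D4 by linarith
    qed
    finally show ?thesis by (simp only: of_nat_less_iff)
  qed
  obtain G :: "nat monoid" and S where G: "group G" "residually_finite G" "finite S" "S \<subseteq> carrier G"
      "generate G S = carrier G" "rf_growth G S 0 = 0"
    and lower: "\<And>n k. 4 * 2 ^ k + 4 \<le> n \<Longrightarrow> F (D * 2 ^ k) \<le> rf_growth G S n"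
    and upper': "\<And>n k. n \<le> 2 ^ k \<Longrightarrow>
      real (rf_growth G S n) \<le> 4 * ln (real (F (D * 2 ^ k))) * (real (F (D * 2 ^ k)))\<^sup>2"
    using group_from_growth_function [OF assms(1) large] by blast
  have upper: "real (rf_growth G S n) \<le> 4 * ln (real (F N)) * (real (F N))\<^sup>2"
    if n: "1 \<le> n" and N: "2 * D * n \<le> N" for n N
  proof -
    \<comment> \<open>Rounding \<open>n\<close> up to a power of two costs the factor 2 in
      \<open>2 * D * n\<close>.\<close>
    obtain k where k: "2 ^ k \<le> n" "n < 2 ^ (k + 1)" using ex_power_ivl1 [of 2 n] n by auto
    have "2 * D * 2 ^ k \<le> 2 * D * n" using k(1) by (intro mult_left_mono) simp_all
    moreover have "D * 2 ^ (k + 1) = 2 * D * 2 ^ k" by simp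
    ultimately have "D * 2 ^ (k + 1) \<le> N" using N by linarith
    then have le: "F (D * 2 ^ (k + 1)) \<le> F N" by (rule F_mono)
    have pos: "1 \<le> F (D * 2 ^ (k + 1))" using large [of "k + 1"] by linarith
    have "real (rf_growth G S n) \<le> 4 * ln (real (F (D * 2 ^ (k + 1)))) * (real (F (D * 2 ^ (k + 1))))\<^sup>2"
      by (rule upper') (use k(2) in simp)
    also have "\<dots> \<le> 4 * ln (real (F N)) * (real (F N))\<^sup>2"
      using le pos by (intro mult_mono power_mono) auto
    finally show ?thesis .
  qed
  \<comment> \<open>From \<open>n0\<close> on, \<open>F\<close> is large enough for
    \<open>log_factor_absorbed\<close>.\<close>
  define n0 :: nat where "n0 = nat \<lceil>exp (exp 1) / \<gamma>\<rceil> + 4"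
  have F_n0: "exp (exp (exp 1)) \<le> real (F n)" if "n0 \<le> n" for n
  proof -
    have "exp (exp 1) / \<gamma> \<le> real n" using that of_nat_ceiling [of "exp (exp 1) / \<gamma>"] unfolding n0_def by linarith
    then have "exp (exp 1) \<le> \<gamma> * real n" using \<gamma> by (simp add: pos_divide_le_eq mult.commute)
    then have "exp (exp (exp 1)) \<le> exp (\<gamma> * real n)" by simp
    also have "\<dots> \<le> real (F n)" using that by (intro F_exp) (simp add: n0_def)
    finally show ?thesis .
  qed
  define W where "W = F (2 * D * n0)"
  \<comment> \<open>For positive \<open>n\<close> below \<open>n0\<close> the growth is at most 4
    W^3, using ln W \<le> W. The additive constant \<open>c2\<close> is taken as \<open>q\<close> so
    that \<open>F q\<close> alone covers these cases.\<close>
  define q :: nat where "q = nat \<lceil>real (4 * W * W\<^sup>2) / \<gamma>\<rceil> + 4"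
  have F_q: "real (4 * W * W\<^sup>2) \<le> real (F q)"
  proof -
    have "real (4 * W * W\<^sup>2) / \<gamma> \<le> real q" unfolding q_def using of_nat_ceiling [of "real (4 * W * W\<^sup>2) / \<gamma>"] by simp
    then have "real (4 * W * W\<^sup>2) \<le> \<gamma> * real q" using \<gamma> by (simp add: pos_divide_le_eq mult.commute)
    also have "\<dots> \<le> exp (\<gamma> * real q)" using exp_ge_add_one_self [of "\<gamma> * real q"] by linarith
    also have "\<dots> \<le> real (F q)" by (intro F_exp) (simp add: q_def)
    finally show ?thesis .
  qed
  have q4: "4 \<le> q" by (simp add: q_def)
  \<comment> \<open>The summand 2D serves the upper bound through \<open>upper\<close>; the 8 serves
    the rounding in the lower bound.\<close>
  define c1 where "c1 = real (2 * D + 8)"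
  define c2 where "c2 = real q"
  have low: "real (at_real F (real n / c1 - c2)) powr (1 - 12 * iterated_log_ratio (real (F n))) \<le> real (rf_growth G S n)"
    if n: "0 < real n / c1 - c2" for n
  proof -
    define N where "N = nat \<lceil>real n / c1 - c2\<rceil>"
    have c18: "8 \<le> c1" and c22: "4 \<le> c2" using q4 by (simp_all add: c1_def c2_def)
    have "8 * c2 \<le> c1 * c2" using c18 c22 by (intro mult_right_mono) auto
    moreover have "c1 * c2 < real n" using n c18 by (simp add: pos_less_divide_eq mult.commute)
    ultimately have n32: "32 < n" using c22 by linarith
    \<comment> \<open>The largest \<open>m\<close> with 4m + 4 \<le> n, positive since n > c1 c2
      \<ge> 32. Rounding \<open>m\<close> down to a power of two loses another factor 2, so n is at
      most about 8 * 2^k, and division by \<open>c1\<close> brings \<open>N\<close> below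
      2^k.\<close>
    define m where "m = (n - 4) div 4"
    have m: "1 \<le> m" "4 * m + 4 \<le> n" "n < 4 * m + 8" using n32 unfolding m_def by linarith+
    obtain k where k: "2 ^ k \<le> m" "m < 2 ^ (k + 1)" using ex_power_ivl1 [of 2 m] m(1) by auto
    have "real n / c1 \<le> real n / 8" using c18 by (intro divide_left_mono) auto
    then have "real N \<le> real n / 8 - 3" using n c22 unfolding N_def by linarith
    moreover have "real n \<le> 8 * 2 ^ k + 4"
    proof -
      have "n \<le> 8 * 2 ^ k + 4" using k(2) m(3) by simp
      then have "real n \<le> real (8 * 2 ^ k + 4)" by (simp only: of_nat_le_iff)
      then show ?thesis by simp
    qed
    ultimately have "real N \<le> 2 ^ k" by linarith
    then have "real N \<le> real (2 ^ k)" by simp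
    then have "N \<le> 2 ^ k" by (simp only: of_nat_le_iff)
    also have "(2 :: nat) ^ k \<le> D * 2 ^ k" using D4 by simp
    finally have "F N \<le> F (D * 2 ^ k)" by (rule F_mono)
    also have "\<dots> \<le> rf_growth G S n" by (rule lower) (use k(1) m(2) in linarith)
    finally have le: "F N \<le> rf_growth G S n" .
    \<comment> \<open>The exponent is at most 1 and a positive natural base is at least 1. The base
      0 is separate, where \<open>powr\<close> gives 0.\<close>
    have "real (F N) powr (1 - 12 * iterated_log_ratio (real (F n))) \<le> real (F N)"
    proof (cases "F N = 0")
      case False
      then have "real (F N) powr (1 - 12 * iterated_log_ratio (real (F n))) \<le> real (F N) powr 1"
        using iterated_log_ratio_nonneg by (intro powr_mono) auto
      then show ?thesis using False by simp
    qed simp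
    then show ?thesis using le by (simp add: at_real_def N_def)
  qed
  have up: "real (rf_growth G S n) \<le> real (at_real F (c1 * real n + c2)) powr (2 + 12 * iterated_log_ratio (real (F n)))" for n
  \<comment> \<open>At radius 0 there is no power of two below \<open>n\<close>; the growth there is
    0.\<close>
  proof (cases "n = 0")
    case True
    then show ?thesis by (simp add: G(6))
  next
    case False
    then have n1: "1 \<le> n" by simp
    define N where "N = (2 * D + 8) * n + q"
    have "c1 * real n + c2 = real N" by (simp add: c1_def c2_def N_def)
    then have at: "at_real F (c1 * real n + c2) = F N" by (simp add: at_real_def)
    show ?thesis
    proof (cases "n0 \<le> n")
      case True
      have "real (rf_growth G S n) \<le> 4 * ln (real (F N)) * (real (F N))\<^sup>2"
        by (rule upper [OF n1]) (simp add: N_def add_mult_distrib)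
      also have "\<dots> \<le> real (F N) powr (2 + 12 * iterated_log_ratio (real (F n)))"
      proof (rule log_factor_absorbed [OF F_n0 [OF True]])
        have "n \<le> N" by (simp add: N_def add_mult_distrib)
        then show "real (F n) \<le> real (F N)" using F_mono by simp
      qed
      finally show ?thesis by (simp add: at)
    next
      case False
      have W: "1 \<le> W"
      proof -
        have "D \<le> 2 * D * n0" by (simp add: n0_def)
        then have "F (D * 2 ^ 0) \<le> W" unfolding W_def by (intro F_mono) simp
        then show ?thesis using large [of 0] by linarith
      qed
      have "real (rf_growth G S n) \<le> 4 * ln (real W) * (real W)\<^sup>2"
        unfolding W_def by (rule upper [OF n1]) (use False in simp)
      also have "\<dots> \<le> 4 * real W * (real W)\<^sup>2"
        using W ln_le_minus_one [of "real W"] by (intro mult_right_mono) auto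
      also have "\<dots> \<le> real (F q)" using F_q by simp
      also have "\<dots> \<le> real (F N)" using F_mono [of q N] by (simp add: N_def)
      finally have le: "real (rf_growth G S n) \<le> real (F N)" .
      \<comment> \<open>The base must be at least 1 before the exponent can be raised from
        1.\<close>
      have "0 < real (F q)" using F_exp [OF q4] exp_gt_zero [of "\<gamma> * real q"] by linarith
      then have "1 \<le> real (F N)" using F_mono [of q N] by (simp add: N_def)
      then have "real (F N) powr 1 \<le> real (F N) powr (2 + 12 * iterated_log_ratio (real (F n)))"
        using iterated_log_ratio_nonneg [of "real (F n)"] by (intro powr_mono) auto
      then show ?thesis using le \<open>1 \<le> real (F N)\<close> by (simp add: at)
    qed
  qed
  have "1 < c1" "1 < c2" using q4 by (simp_all add: c1_def c2_def)
  moreover have "(1 :: real) < 12" by simp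
  ultimately show ?thesis using G(1-5) low up by blast
qed

end
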